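(* Let $\alpha_1$ be a primitive $p$-th root of unity and $\alpha_2$ a primitive $q$-th root of unity, $p,q\in\mathbb{N}$, let $\varphi(z_1,z_2)=(\alpha_1z_1,\alpha_2z_2)$ for $(z_1,z_2)\in\mathbb{D}^2$, and let $m=\mathrm{lcm}(p,q)$. Let $w\in\mathbb{A}^2$ and let $T:\mathbb{A}^2\to\mathbb{A}^2$ be the operator $(Tf)(z)=w(z)f(\varphi(z))$. Then (1) $\sigma(T)=\sigma_{lsf}(T)=\{\lambda\in\mathbb{C}:\exists t\in\mathbb{D}^2,\ \lambda^m=w_m(t)\}$; (2) $\sigma_{a.p.}(T)=\sigma_{sf}(T)=\{\lambda\in\mathbb{C}:\exists t\in\mathbb{T}^2,\ \lambda^m=w_m(t)\}$.
   Context: $\mathbb{D}$, $\mathbb{U}$ and $\mathbb{T}$ are the closed unit disc, the open unit disc and the unit circle in $\mathbb{C}$; $\mathbb{N}=\{1,2,\dots\}$. $\mathbb{A}^2$ is the bidisc algebra: all functions continuous on $\mathbb{D}^2$ and analytic in $\mathbb{U}^2$, with the sup norm; its maximal ideal space is $\mathbb{D}^2$ and its Shilov boundary is $\mathbb{T}^2$. For a self-map $\varphi$ and a function $w$: $w_1=w$, $w_n=w_{n-1}\,(w\circ\varphi^{n-1})$ for $n\ge2$, where $\varphi^{k}$ is the $k$-th iterate. For a bounded linear operator $T$ on a Banach space $X$: $T$ is upper semi-Fredholm if its range is closed and $\dim\ker T<\infty$; lower semi-Fredholm if its range has finite codimension; semi-Fredholm if it is upper or lower semi-Fredholm. $\sigma(T)$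 is the spectrum; $\sigma_{a.p.}(T)$ is the approximate point spectrum (the set of $\lambda$ for which there are $x_n\in X$, $\|x_n\|=1$, with $Tx_n-\lambda x_n\to0$); $\sigma_{sf}(T)$ and $\sigma_{lsf}(T)$ are the sets of $\lambda\in\mathbb{C}$ such that $\lambda I-T$ is not semi-Fredholm, respectively not lower semi-Fredholm. *)

theory Defs
  imports "HOL-Complex_Analysis.Complex_Analysis"
begin

section \<open>Complex Banach spaces and operators on them\<close>

class scaleC =
  fixes scaleC :: "complex \<Rightarrow> 'a \<Rightarrow> 'a"  (infixr "*\<^sub>C" 75)

class complex_normed_vector = real_normed_vector + scaleC +
  assumes scaleC_add_right: "a *\<^sub>C (x + y) = a *\<^sub>C x + a *\<^sub>C y"
    and scaleC_add_left: "(a + b) *\<^sub>C x = a *\<^sub>C x + b *\<^sub>C x"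
    and scaleC_scaleC: "a *\<^sub>C (b *\<^sub>C x) = (a * b) *\<^sub>C x"
    and scaleC_of_real: "complex_of_real r *\<^sub>C x = r *\<^sub>R x"
    and norm_scaleC: "norm (a *\<^sub>C x) = cmod a * norm x"

class complex_banach = complex_normed_vector + banach

global_interpretation complex_vector: vector_space "scaleC :: complex \<Rightarrow> 'a \<Rightarrow> 'a::complex_normed_vector"
proof
  show "1 *\<^sub>C x = x" for x :: 'a
    using scaleC_of_real[of 1 x] by simp
qed (auto simp: scaleC_add_right scaleC_add_left scaleC_scaleC)

definition bounded_clinear :: "('a::complex_normed_vector \<Rightarrow> 'b::complex_normed_vector) \<Rightarrow> bool" where
  "bounded_clinear T \<longleftrightarrow> bounded_linear T \<and> (\<forall>c x. T (c *\<^sub>C x) = c *\<^sub>C T x)"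

definition shifted :: "complex \<Rightarrow> ('a::complex_normed_vector \<Rightarrow> 'a) \<Rightarrow> 'a \<Rightarrow> 'a" where
  "shifted \<mu> T = (\<lambda>x. \<mu> *\<^sub>C x - T x)"

definition fin_dim :: "'a::complex_normed_vector set \<Rightarrow> bool" where
  "fin_dim S \<longleftrightarrow> (\<exists>B. finite B \<and> S \<subseteq> complex_vector.span B)"

text \<open>Finite codimension: finitely many vectors together with \<open>S\<close> span the space, i.e. the quotient
  by the (complex) span of \<open>S\<close> is finite-dimensional.\<close>

definition fin_codim :: "'a::complex_normed_vector set \<Rightarrow> bool" where
  "fin_codim S \<longleftrightarrow> (\<exists>B. finite B \<and> complex_vector.span (S \<union> B) = UNIV)"

definition upper_semi_Fredholm :: "('a::complex_banach \<Rightarrow> 'a) \<Rightarrow> bool" where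
  "upper_semi_Fredholm T \<longleftrightarrow> bounded_clinear T \<and> closed (range T) \<and> fin_dim {x. T x = 0}"

definition lower_semi_Fredholm :: "('a::complex_banach \<Rightarrow> 'a) \<Rightarrow> bool" where
  "lower_semi_Fredholm T \<longleftrightarrow> bounded_clinear T \<and> fin_codim (range T)"

definition semi_Fredholm :: "('a::complex_banach \<Rightarrow> 'a) \<Rightarrow> bool" where
  "semi_Fredholm T \<longleftrightarrow> upper_semi_Fredholm T \<or> lower_semi_Fredholm T"

definition spectrum :: "('a::complex_banach \<Rightarrow> 'a) \<Rightarrow> complex set" where
  "spectrum T = {\<mu>. \<not> (\<exists>S. bounded_clinear S \<and> S \<circ> shifted \<mu> T = id \<and> shifted \<mu> T \<circ> S = id)}"

definition approx_point_spectrum :: "('a::complex_banach \<Rightarrow> 'a) \<Rightarrow> complex set" where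
  "approx_point_spectrum T =
     {\<mu>. \<exists>x :: nat \<Rightarrow> 'a. (\<forall>n. norm (x n) = 1) \<and> (\<lambda>n. T (x n) - \<mu> *\<^sub>C x n) \<longlonglongrightarrow> 0}"

definition semi_Fredholm_spectrum :: "('a::complex_banach \<Rightarrow> 'a) \<Rightarrow> complex set" where
  "semi_Fredholm_spectrum T = {\<mu>. \<not> semi_Fredholm (shifted \<mu> T)}"

definition lower_semi_Fredholm_spectrum :: "('a::complex_banach \<Rightarrow> 'a) \<Rightarrow> complex set" where
  "lower_semi_Fredholm_spectrum T = {\<mu>. \<not> lower_semi_Fredholm (shifted \<mu> T)}"


section \<open>The bidisc algebra\<close>

abbreviation closed_bidisc :: "(complex \<times> complex) set" where
  "closed_bidisc \<equiv> cball 0 1 \<times> cball 0 1"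

abbreviation open_bidisc :: "(complex \<times> complex) set" where
  "open_bidisc \<equiv> ball 0 1 \<times> ball 0 1"

abbreviation torus :: "(complex \<times> complex) set" where
  "torus \<equiv> sphere 0 1 \<times> sphere 0 1"

text \<open>Complex differentiability in two variables: the Frechet derivative exists and is
  complex linear.  On open sets this is the several-variable counterpart of
  \<^const>\<open>holomorphic_on\<close>.\<close>

definition holomorphic2_on :: "(complex \<times> complex \<Rightarrow> complex) \<Rightarrow> (complex \<times> complex) set \<Rightarrow> bool" where
  "holomorphic2_on f S \<longleftrightarrow>
     (\<forall>z\<in>S. \<exists>a b. (f has_derivative (\<lambda>h. a * fst h + b * snd h)) (at z within S))"

lemma holomorphic2_onI:
  "(\<And>z. z \<in> S \<Longrightarrow> \<exists>a b. (f has_derivative (\<lambda>h. a * fst h + b * snd h)) (at z within S)) \<Longrightarrow> holomorphic2_on f S"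
  by (auto simp: holomorphic2_on_def)

lemma holomorphic2_on_add:
  assumes "holomorphic2_on f S" "holomorphic2_on g S"
  shows "holomorphic2_on (\<lambda>z. f z + g z) S"
proof (rule holomorphic2_onI)
  fix z assume "z \<in> S"
  then obtain a b c d where
    "(f has_derivative (\<lambda>h. a * fst h + b * snd h)) (at z within S)"
    "(g has_derivative (\<lambda>h. c * fst h + d * snd h)) (at z within S)"
    using assms unfolding holomorphic2_on_def by meson
  from has_derivative_add[OF this]
  have "((\<lambda>z. f z + g z) has_derivative (\<lambda>h. (a + c) * fst h + (b + d) * snd h)) (at z within S)"
    by (simp add: algebra_simps)
  then show "\<exists>a b. ((\<lambda>z. f z + g z) has_derivative (\<lambda>h. a * fst h + b * snd h)) (at z within S)"
    by blast
qed

lemma holomorphic2_on_cmult: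
  assumes "holomorphic2_on f S"
  shows "holomorphic2_on (\<lambda>z. c * f z) S"
proof (rule holomorphic2_onI)
  fix z assume "z \<in> S"
  then obtain a b where
    "(f has_derivative (\<lambda>h. a * fst h + b * snd h)) (at z within S)"
    using assms unfolding holomorphic2_on_def by meson
  from has_derivative_mult_right[OF this, of c]
  have "((\<lambda>z. c * f z) has_derivative (\<lambda>h. (c * a) * fst h + (c * b) * snd h)) (at z within S)"
    by (simp add: algebra_simps)
  then show "\<exists>a b. ((\<lambda>z. c * f z) has_derivative (\<lambda>h. a * fst h + b * snd h)) (at z within S)"
    by blast
qed

lemma holomorphic2_on_const: "holomorphic2_on (\<lambda>z. c) S"
  unfolding holomorphic2_on_def by (auto intro!: exI[of _ 0])

lemma open_open_bidisc: "open open_bidisc"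
  by (intro open_Times) auto

lemma partial_bounds:
  fixes f :: "complex \<times> complex \<Rightarrow> complex"
  assumes der: "\<And>x. x \<in> S \<Longrightarrow> (f has_derivative (\<lambda>h. A x * fst h + B x * snd h)) (at x)"
    and S: "cball (fst z) r \<times> cball (snd z) r \<subseteq> S" and r: "r > 0"
    and bd: "\<And>x. x \<in> S \<Longrightarrow> cmod (f x) \<le> M"
  shows "cmod (A z) \<le> M / r" "cmod (B z) \<le> M / r"
proof -
  obtain u v where z: "z = (u, v)" by (cases z)
  have d1: "((\<lambda>t. f (t, v)) has_field_derivative A (t, v)) (at t)" if "t \<in> cball u r" for t
  proof -
    have "(t, v) \<in> S" using that S r z by auto
    have "((\<lambda>t. (t, v)) has_derivative (\<lambda>h. (h, 0))) (at t)"
      by (auto intro!: derivative_eq_intros)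
    from has_derivative_compose[OF this, where g=f, OF der[OF \<open>(t, v) \<in> S\<close>]]
    have "((\<lambda>t. f (t, v)) has_derivative (\<lambda>h. A (t, v) * h)) (at t)"
      by simp
    then show ?thesis by (simp add: has_field_derivative_def)
  qed
  have d2: "((\<lambda>t. f (u, t)) has_field_derivative B (u, t)) (at t)" if "t \<in> cball v r" for t
  proof -
    have "(u, t) \<in> S" using that S r z by auto
    have "((\<lambda>t. (u, t)) has_derivative (\<lambda>h. (0, h))) (at t)"
      by (auto intro!: derivative_eq_intros)
    from has_derivative_compose[OF this, where g=f, OF der[OF \<open>(u, t) \<in> S\<close>]]
    have "((\<lambda>t. f (u, t)) has_derivative (\<lambda>h. B (u, t) * h)) (at t)"
      by simp
    then show ?thesis by (simp add: has_field_derivative_def)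
  qed
  have "cmod ((deriv ^^ 1) (\<lambda>t. f (t, v)) u) \<le> fact 1 * M / r ^ 1"
  proof (rule Cauchy_inequality)
    show "(\<lambda>t. f (t, v)) holomorphic_on ball u r"
      using d1 by (metis ball_subset_cball holomorphic_on_open open_ball subsetD)
    show "continuous_on (cball u r) (\<lambda>t. f (t, v))"
      by (rule DERIV_continuous_on[OF has_field_derivative_at_within[OF d1]])
    show "cmod (f (t, v)) \<le> M" if "cmod (u - t) = r" for t
      using S r z that by (intro bd) (auto simp: dist_norm)
  qed (use r in auto)
  then show "cmod (A z) \<le> M / r"
    using DERIV_imp_deriv[OF d1[of u]] r z by simp
  have "cmod ((deriv ^^ 1) (\<lambda>t. f (u, t)) v) \<le> fact 1 * M / r ^ 1"
  proof (rule Cauchy_inequality)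
    show "(\<lambda>t. f (u, t)) holomorphic_on ball v r"
      using d2 by (metis ball_subset_cball holomorphic_on_open open_ball subsetD)
    show "continuous_on (cball v r) (\<lambda>t. f (u, t))"
      by (rule DERIV_continuous_on[OF has_field_derivative_at_within[OF d2]])
    show "cmod (f (u, t)) \<le> M" if "cmod (v - t) = r" for t
      using S r z that by (intro bd) (auto simp: dist_norm)
  qed (use r in auto)
  then show "cmod (B z) \<le> M / r"
    using DERIV_imp_deriv[OF d2[of v]] r z by simp
qed

lemma holomorphic2_on_uniform_limit:
  fixes f :: "nat \<Rightarrow> complex \<times> complex \<Rightarrow> complex"
  assumes S: "open S" and hol: "\<And>n. holomorphic2_on (f n) S"
    and lim: "uniform_limit S f g sequentially"
  shows "holomorphic2_on g S"
proof (rule holomorphic2_onI)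
  fix z assume z: "z \<in> S"
  have "\<forall>n. \<forall>x\<in>S. \<exists>a b. (f n has_derivative (\<lambda>h. a * fst h + b * snd h)) (at x)"
    using hol S by (simp add: holomorphic2_on_def at_within_open[OF _ S])
  then obtain A B where
    der: "\<And>n x. x \<in> S \<Longrightarrow> (f n has_derivative (\<lambda>h. A n x * fst h + B n x * snd h)) (at x)"
    by metis
  obtain s where s: "s > 0" "ball z s \<subseteq> S"
    using S z open_contains_ball by blast
  define r where "r = s / 4"
  define V where "V = ball z r"
  have r: "r > 0" using s by (simp add: r_def)
  have sub: "cball (fst x) r \<times> cball (snd x) r \<subseteq> S" if "x \<in> V" for x
  proof
    fix y assume y: "y \<in> cball (fst x) r \<times> cball (snd x) r"
    have "dist x y \<le> dist (fst x) (fst y) + dist (snd x) (snd y)"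
      unfolding dist_prod_def by (rule sqrt_sum_squares_le_sum) auto
    also have "\<dots> \<le> r + r" using y by (intro add_mono) auto
    finally have "dist z y < s"
      using dist_triangle[of z y x] that r by (auto simp: V_def r_def)
    then show "y \<in> S" using s by auto
  qed
  have Vsub: "V \<subseteq> S" using s by (auto simp: V_def r_def)
  have cauchy: "\<exists>N. \<forall>m\<ge>N. \<forall>n\<ge>N. \<forall>x\<in>V. cmod (A m x - A n x) \<le> e \<and> cmod (B m x - B n x) \<le> e"
    if e: "e > 0" for e
  proof -
    have "uniformly_Cauchy_on S f"
      using lim uniformly_convergent_on_def uniformly_convergent_eq_Cauchy by blast
    then obtain N where N: "\<And>x m n. x \<in> S \<Longrightarrow> m \<ge> N \<Longrightarrow> n \<ge> N \<Longrightarrow> dist (f m x) (f n x) < e * r"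
      using e r unfolding uniformly_Cauchy_on_def by (metis mult_pos_pos)
    show ?thesis
    proof (intro exI allI impI ballI)
      fix m n x assume mn: "m \<ge> N" "n \<ge> N" and x: "x \<in> V"
      have d: "((\<lambda>x. f m x - f n x) has_derivative
          (\<lambda>h. (A m y - A n y) * fst h + (B m y - B n y) * snd h)) (at y)" if "y \<in> S" for y
        using has_derivative_diff[OF der[OF that] der[OF that], of m n] by (simp add: algebra_simps)
      have bd: "cmod (f m y - f n y) \<le> e * r" if "y \<in> S" for y
        using N[OF that mn] by (simp add: dist_norm)
      show "cmod (A m x - A n x) \<le> e \<and> cmod (B m x - B n x) \<le> e"
        using partial_bounds[where A="\<lambda>y. A m y - A n y" and B="\<lambda>y. B m y - B n y", OF d sub[OF x] r bd] r
        by simp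
    qed
  qed
  have "uniformly_Cauchy_on V A" "uniformly_Cauchy_on V B"
  proof -
    show "uniformly_Cauchy_on V A"
    proof (rule uniformly_Cauchy_onI)
      fix e :: real assume "e > 0"
      with cauchy[of "e/2"] obtain N where
        N: "\<And>m n x. m \<ge> N \<Longrightarrow> n \<ge> N \<Longrightarrow> x \<in> V \<Longrightarrow> cmod (A m x - A n x) \<le> e/2"
        by (metis half_gt_zero)
      have "dist (A m x) (A n x) < e" if "m \<ge> N" "n \<ge> N" "x \<in> V" for m n x
        using N[OF that] \<open>e > 0\<close> by (simp add: dist_norm)
      then show "\<exists>M. \<forall>x\<in>V. \<forall>m\<ge>M. \<forall>n\<ge>M. dist (A m x) (A n x) < e"
        by blast
    qed
    show "uniformly_Cauchy_on V B"
    proof (rule uniformly_Cauchy_onI)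
      fix e :: real assume "e > 0"
      with cauchy[of "e/2"] obtain N where
        N: "\<And>m n x. m \<ge> N \<Longrightarrow> n \<ge> N \<Longrightarrow> x \<in> V \<Longrightarrow> cmod (B m x - B n x) \<le> e/2"
        by (metis half_gt_zero)
      have "dist (B m x) (B n x) < e" if "m \<ge> N" "n \<ge> N" "x \<in> V" for m n x
        using N[OF that] \<open>e > 0\<close> by (simp add: dist_norm)
      then show "\<exists>M. \<forall>x\<in>V. \<forall>m\<ge>M. \<forall>n\<ge>M. dist (B m x) (B n x) < e"
        by blast
    qed
  qed
  then obtain A' B' where AB: "uniform_limit V A A' sequentially" "uniform_limit V B B' sequentially"
    using uniformly_convergent_eq_Cauchy uniformly_convergent_on_def by metis
  have "\<exists>G. \<forall>x\<in>V. (\<lambda>n. f n x) \<longlonglongrightarrow> G x \<and>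
      (G has_derivative (\<lambda>h. A' x * fst h + B' x * snd h)) (at x within V)"
  proof (rule has_derivative_sequence)
    show "convex V" by (simp add: V_def)
    show "(f n has_derivative (\<lambda>h. A n x * fst h + B n x * snd h)) (at x within V)" if "x \<in> V" for n x
      using der Vsub that has_derivative_at_withinI by blast
    show "\<forall>\<^sub>F n in sequentially. \<forall>x\<in>V. \<forall>h. norm (A n x * fst h + B n x * snd h -
        (A' x * fst h + B' x * snd h)) \<le> e * norm h" if e: "e > 0" for e
    proof -
      have "\<forall>\<^sub>F n in sequentially. \<forall>x\<in>V. dist (A n x) (A' x) < e/2"
        "\<forall>\<^sub>F n in sequentially. \<forall>x\<in>V. dist (B n x) (B' x) < e/2"
        using uniform_limitD[OF AB(1), of "e/2"] uniform_limitD[OF AB(2), of "e/2"] e by simp_all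
      then show ?thesis
      proof eventually_elim
        case (elim n)
        show ?case
        proof (intro ballI allI)
          fix x h assume x: "x \<in> V"
          have "norm (A n x * fst h + B n x * snd h - (A' x * fst h + B' x * snd h))
              = norm ((A n x - A' x) * fst h + (B n x - B' x) * snd h)"
            by (simp add: algebra_simps)
          also have "\<dots> \<le> norm (A n x - A' x) * norm (fst h) + norm (B n x - B' x) * norm (snd h)"
            by (metis norm_mult norm_triangle_ineq)
          also have "\<dots> \<le> e/2 * norm h + e/2 * norm h"
            using elim x e
            by (intro add_mono mult_mono) (auto simp: dist_norm less_imp_le norm_fst_le[of "fst h" "snd h", simplified] norm_snd_le[of "snd h" "fst h", simplified])
          finally show "norm (A n x * fst h + B n x * snd h - (A' x * fst h + B' x * snd h)) \<le> e * norm h"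
            by simp
        qed
      qed
    qed
    show "z \<in> V" using r by (simp add: V_def)
    show "(\<lambda>n. f n z) \<longlonglongrightarrow> g z" by (rule tendsto_uniform_limitI[OF lim z])
  qed
  then obtain G where G: "\<And>x. x \<in> V \<Longrightarrow> (\<lambda>n. f n x) \<longlonglongrightarrow> G x"
    "\<And>x. x \<in> V \<Longrightarrow> (G has_derivative (\<lambda>h. A' x * fst h + B' x * snd h)) (at x within V)"
    by metis
  have Gg: "G x = g x" if "x \<in> V" for x
    by (rule LIMSEQ_unique[OF G(1)[OF that] tendsto_uniform_limitI[OF lim subsetD[OF Vsub that]]])
  have zV: "z \<in> V" using r by (simp add: V_def)
  have "(G has_derivative (\<lambda>h. A' z * fst h + B' z * snd h)) (at z)"
    using G(2)[OF zV] at_within_open[OF zV] by (simp add: V_def)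
  then have "(g has_derivative (\<lambda>h. A' z * fst h + B' z * snd h)) (at z)"
    by (rule has_derivative_transform_within_open[of _ _ _ _ V]) (use zV Gg V_def in auto)
  then show "\<exists>a b. (g has_derivative (\<lambda>h. a * fst h + b * snd h)) (at z within S)"
    by (blast intro: has_derivative_at_withinI)
qed

text \<open>Elements of the bidisc algebra are functions on the closed bidisc; as HOL functions are
  total, each is represented by its extension by \<open>0\<close>.\<close>

typedef bidisc_algebra =
  "{f :: complex \<times> complex \<Rightarrow> complex. continuous_on closed_bidisc f \<and> holomorphic2_on f open_bidisc
      \<and> (\<forall>z. z \<notin> closed_bidisc \<longrightarrow> f z = 0)}"
  morphisms bd_apply Bidisc
  by (rule exI[of _ "\<lambda>_. 0"]) (auto intro: holomorphic2_on_const)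

setup_lifting type_definition_bidisc_algebra

lemma bd_apply_props:
  "continuous_on closed_bidisc (bd_apply f)" "holomorphic2_on (bd_apply f) open_bidisc"
  "z \<notin> closed_bidisc \<Longrightarrow> bd_apply f z = 0"
  using bd_apply[of f] by blast+

lemma bd_eqI: "(\<And>z. z \<in> closed_bidisc \<Longrightarrow> bd_apply f z = bd_apply g z) \<Longrightarrow> f = g"
  by (metis bd_apply_inject bd_apply_props(3) ext)

lemma bd_bounded: "bdd_above ((\<lambda>z. cmod (bd_apply f z)) ` closed_bidisc)"
proof -
  have "compact ((\<lambda>z. cmod (bd_apply f z)) ` closed_bidisc)"
    by (intro compact_continuous_image continuous_on_norm bd_apply_props compact_Times compact_cball)
  then show ?thesis by (simp add: bounded_imp_bdd_above compact_imp_bounded)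
qed

instantiation bidisc_algebra :: complex_normed_vector
begin

lift_definition zero_bidisc_algebra :: bidisc_algebra is "\<lambda>_. 0"
  by (auto intro: holomorphic2_on_const)

lift_definition plus_bidisc_algebra :: "bidisc_algebra \<Rightarrow> bidisc_algebra \<Rightarrow> bidisc_algebra"
  is "\<lambda>f g z. f z + g z"
  by (auto intro!: continuous_on_add holomorphic2_on_add)

lift_definition scaleC_bidisc_algebra :: "complex \<Rightarrow> bidisc_algebra \<Rightarrow> bidisc_algebra"
  is "\<lambda>c f z. c * f z"
  by (auto intro!: continuous_on_mult continuous_on_const holomorphic2_on_cmult)

definition scaleR_bidisc_algebra :: "real \<Rightarrow> bidisc_algebra \<Rightarrow> bidisc_algebra" where
  "scaleR_bidisc_algebra r f = complex_of_real r *\<^sub>C f"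

definition uminus_bidisc_algebra :: "bidisc_algebra \<Rightarrow> bidisc_algebra" where
  "uminus_bidisc_algebra f = (-1) *\<^sub>C f"

definition minus_bidisc_algebra :: "bidisc_algebra \<Rightarrow> bidisc_algebra \<Rightarrow> bidisc_algebra" where
  "minus_bidisc_algebra f g = f + (- g)"

definition norm_bidisc_algebra :: "bidisc_algebra \<Rightarrow> real" where
  "norm_bidisc_algebra f = (SUP z\<in>closed_bidisc. cmod (bd_apply f z))"

definition dist_bidisc_algebra :: "bidisc_algebra \<Rightarrow> bidisc_algebra \<Rightarrow> real" where
  "dist_bidisc_algebra f g = norm (f - g)"

definition sgn_bidisc_algebra :: "bidisc_algebra \<Rightarrow> bidisc_algebra" where
  "sgn_bidisc_algebra f = inverse (norm f) *\<^sub>R f"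

definition uniformity_bidisc_algebra :: "(bidisc_algebra \<times> bidisc_algebra) filter" where
  "uniformity_bidisc_algebra = (INF e\<in>{0 <..}. principal {(x, y). dist x y < e})"

definition open_bidisc_algebra :: "bidisc_algebra set \<Rightarrow> bool" where
  "open_bidisc_algebra U \<longleftrightarrow> (\<forall>x\<in>U. \<forall>\<^sub>F (x', y) in uniformity. x' = x \<longrightarrow> y \<in> U)"

lemma bd_apply_simps [simp]:
  "bd_apply 0 z = 0"
  "bd_apply (f + g) z = bd_apply f z + bd_apply g z"
  "bd_apply (c *\<^sub>C f) z = c * bd_apply f z"
  "bd_apply (r *\<^sub>R f) z = complex_of_real r * bd_apply f z"
  "bd_apply (- f) z = - bd_apply f z"
  "bd_apply (f - g) z = bd_apply f z - bd_apply g z"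
  by (simp_all add: zero_bidisc_algebra.rep_eq plus_bidisc_algebra.rep_eq scaleC_bidisc_algebra.rep_eq
      scaleR_bidisc_algebra_def uminus_bidisc_algebra_def minus_bidisc_algebra_def)

lemma bd_norm_upper: "z \<in> closed_bidisc \<Longrightarrow> cmod (bd_apply f z) \<le> norm f"
  unfolding norm_bidisc_algebra_def by (rule cSUP_upper[OF _ bd_bounded])

lemma bd_norm_least: "(\<And>z. z \<in> closed_bidisc \<Longrightarrow> cmod (bd_apply f z) \<le> M) \<Longrightarrow> norm f \<le> M"
  unfolding norm_bidisc_algebra_def by (rule cSUP_least) simp_all

lemma bd_norm_nonneg: "norm (f :: bidisc_algebra) \<ge> 0"
  using order_trans[OF norm_ge_zero bd_norm_upper[of "(0, 0)" f]] by simp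

lemma bd_norm_scaleC: "norm (c *\<^sub>C f) = cmod c * norm (f :: bidisc_algebra)"
proof (rule antisym)
  have le: "norm (a *\<^sub>C g) \<le> cmod a * norm g" for a and g :: bidisc_algebra
    by (rule bd_norm_least) (simp add: norm_mult mult_left_mono bd_norm_upper)
  show "norm (c *\<^sub>C f) \<le> cmod c * norm f" by (rule le)
  show "cmod c * norm f \<le> norm (c *\<^sub>C f)"
  proof (cases "c = 0")
    case True
    then show ?thesis by (simp add: bd_norm_nonneg)
  next
    case False
    have "f = inverse c *\<^sub>C (c *\<^sub>C f)"
      by (rule bd_eqI) (simp add: False)
    then have "norm f \<le> cmod (inverse c) * norm (c *\<^sub>C f)"
      using le[of "inverse c" "c *\<^sub>C f"] by simp
    then have "cmod c * norm f \<le> cmod c * (cmod (inverse c) * norm (c *\<^sub>C f))"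
      by (rule mult_left_mono) simp
    also have "\<dots> = norm (c *\<^sub>C f)"
      using False by (simp add: norm_inverse)
    finally show ?thesis .
  qed
qed

instance
proof
  fix f g h :: bidisc_algebra and a b :: real and c d :: complex
  show "norm f = 0 \<longleftrightarrow> f = 0"
  proof
    assume "norm f = 0"
    then show "f = 0" using bd_norm_upper[of _ f] by (intro bd_eqI) auto
  next
    assume "f = 0"
    then have "norm f \<le> 0" by (intro bd_norm_least) simp
    then show "norm f = 0" using bd_norm_nonneg[of f] by simp
  qed
  show "norm (f + g) \<le> norm f + norm g"
    by (rule bd_norm_least) (auto intro!: norm_triangle_le add_mono bd_norm_upper)
  show "norm (c *\<^sub>C f) = cmod c * norm f" by (rule bd_norm_scaleC)
  show "norm (a *\<^sub>R f) = \<bar>a\<bar> * norm f"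
    by (simp add: scaleR_bidisc_algebra_def bd_norm_scaleC)
  show "dist f g = norm (f - g)" by (rule dist_bidisc_algebra_def)
  show "sgn f = inverse (norm f) *\<^sub>R f" by (rule sgn_bidisc_algebra_def)
  show "uniformity = (INF e\<in>{0 <..}. principal {(x, y :: bidisc_algebra). dist x y < e})"
    by (rule uniformity_bidisc_algebra_def)
  show "open U \<longleftrightarrow> (\<forall>x\<in>U. \<forall>\<^sub>F (x', y) in uniformity. x' = x \<longrightarrow> y \<in> U)" for U :: "bidisc_algebra set"
    by (rule open_bidisc_algebra_def)
qed (rule bd_eqI; simp add: algebra_simps)+

end

instance bidisc_algebra :: complex_banach
proof
  fix X :: "nat \<Rightarrow> bidisc_algebra" assume X: "Cauchy X"
  have "uniformly_Cauchy_on closed_bidisc (\<lambda>n. bd_apply (X n))"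
  proof (rule uniformly_Cauchy_onI)
    fix e :: real assume "e > 0"
    then obtain N where N: "\<And>m n. m \<ge> N \<Longrightarrow> n \<ge> N \<Longrightarrow> norm (X m - X n) < e"
      using X by (metis CauchyD)
    have "dist (bd_apply (X m) z) (bd_apply (X n) z) < e"
      if "z \<in> closed_bidisc" "m \<ge> N" "n \<ge> N" for z m n
      using bd_norm_upper[OF that(1), of "X m - X n"] N[OF that(2,3)] by (simp add: dist_norm)
    then show "\<exists>M. \<forall>x\<in>closed_bidisc. \<forall>m\<ge>M. \<forall>n\<ge>M. dist (bd_apply (X m) x) (bd_apply (X n) x) < e"
      by blast
  qed
  then obtain l where l: "uniform_limit closed_bidisc (\<lambda>n. bd_apply (X n)) l sequentially"
    using uniformly_convergent_eq_Cauchy uniformly_convergent_on_def by metis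
  define g where "g = (\<lambda>z. if z \<in> closed_bidisc then l z else 0)"
  have lg: "uniform_limit closed_bidisc (\<lambda>n. bd_apply (X n)) g sequentially"
    using l uniform_limit_cong'[of closed_bidisc "\<lambda>n. bd_apply (X n)" "\<lambda>n. bd_apply (X n)" l g]
    by (simp add: g_def)
  have cont: "continuous_on closed_bidisc g"
    by (rule uniform_limit_theorem[OF _ lg]) (auto simp: bd_apply_props)
  have hol: "holomorphic2_on g open_bidisc"
    by (rule holomorphic2_on_uniform_limit[OF open_open_bidisc bd_apply_props(2)])
      (rule uniform_limit_on_subset[OF lg], auto)
  define L where "L = Bidisc g"
  have L: "bd_apply L = g"
    unfolding L_def using cont hol by (intro Bidisc_inverse) (auto simp: g_def)
  have "X \<longlonglongrightarrow> L"
  proof (rule LIMSEQ_I)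
    fix e :: real assume e: "e > 0"
    then have "\<forall>\<^sub>F n in sequentially. \<forall>z\<in>closed_bidisc. dist (bd_apply (X n) z) (g z) < e/2"
      using uniform_limitD[OF lg, of "e/2"] by simp
    then obtain N where N: "\<And>n z. n \<ge> N \<Longrightarrow> z \<in> closed_bidisc \<Longrightarrow> dist (bd_apply (X n) z) (g z) < e/2"
      unfolding eventually_sequentially by blast
    have "norm (X n - L) \<le> e/2" if "n \<ge> N" for n
      using N[OF that] by (intro bd_norm_least) (simp add: L dist_norm less_imp_le)
    then show "\<exists>no. \<forall>n\<ge>no. norm (X n - L) < e"
      using e by (intro exI[of _ N]) force
  qed
  then show "convergent X" by (auto simp: convergent_def)
qed


section \<open>Rotations and cocycles\<close>

definition primitive_root_of_unity :: "nat \<Rightarrow> complex \<Rightarrow> bool" where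
  "primitive_root_of_unity n a \<longleftrightarrow> n \<ge> 1 \<and> a ^ n = 1 \<and> (\<forall>k. 1 \<le> k \<and> k < n \<longrightarrow> a ^ k \<noteq> 1)"

text \<open>\<open>cocycle \<phi> w n\<close> is the weight \<open>w\<^sub>n\<close>, with the empty product at \<open>n = 0\<close>,
  so that \<open>w\<^sub>1 = w\<close>.\<close>

primrec cocycle :: "('a \<Rightarrow> 'a) \<Rightarrow> ('a \<Rightarrow> complex) \<Rightarrow> nat \<Rightarrow> 'a \<Rightarrow> complex" where
  "cocycle \<phi> w 0 = (\<lambda>z. 1)"
| "cocycle \<phi> w (Suc n) = (\<lambda>z. cocycle \<phi> w n z * w ((\<phi> ^^ n) z))"

end

theory Submission
  imports Defs "HOL-Computational_Algebra.Fundamental_Theorem_Algebra"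
begin

text \<open>
  Let \<open>g = \<mu>\<^sup>m - w\<^sub>m\<close>. Since the \<open>m\<close>-th iterate of the rotation is the identity, \<open>\<mu>\<^sup>m - T\<^sup>m\<close> is
  multiplication by \<open>g\<close>, and everything is read off from the zeros of \<open>g\<close>.

  If \<open>g\<close> has no zero on the torus, multiplication by \<open>g\<close> is bounded below by the maximum principle.
  As \<open>\<mu> - T\<close> is a factor of \<open>\<mu>\<^sup>m - T\<^sup>m\<close>, it is bounded below too, so \<open>\<mu>\<close> is not an approximate
  eigenvalue and \<open>\<mu> - T\<close> is upper semi-Fredholm. If \<open>g\<close> has no zero at all, it is invertible in the
  algebra and \<open>\<mu> - T\<close> is invertible.

  For the converse inclusions, information about the single factor \<open>\<mu> - T\<close> has to be turned into
  information about the product \<open>\<mu>\<^sup>m - T\<^sup>m\<close> of all \<open>\<lambda> - T\<close> with \<open>\<lambda>\<^sup>m = \<mu>\<^sup>m\<close>. Multiplication by the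
  coordinate \<open>z\<^sub>i\<close> intertwines \<open>\<lambda> - T\<close> with \<open>\<lambda> - \<alpha>\<^sub>i T\<close>, and \<open>\<alpha>\<^sub>1\<close>, \<open>\<alpha>\<^sub>2\<close> generate the \<open>m\<close>-th roots
  of unity; so a property of \<open>\<mu> - T\<close> that survives division by a coordinate spreads to all factors
  (\<open>eigenvalue_orbit\<close>) and then to the product (\<open>shifted_power_induct\<close>). Being bounded below survives
  because the coordinates are unimodular on the torus. Having range of finite codimension survives
  for \<open>\<lambda> \<noteq> 0\<close> because of \<open>fin_codim_step\<close>, whose point is that the operator induced on a coordinate
  axis has no eigenvalue \<open>\<lambda>\<close> when \<open>\<lambda> - T\<close> has range of finite codimension.

  It remains to see what zeros of \<open>g\<close> mean for multiplication by \<open>g\<close>. A zero on the torus prevents it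
  from being bounded below, by peak functions. Zeros off the torus are never isolated, so there are
  infinitely many, and the range has infinite codimension since it contains no nonzero polynomial in
  a suitable coordinate. Finally, an injective operator with closed range, or with range of finite
  codimension, is bounded below by the bounded inverse theorem; this deals with zeros on the torus
  for a nonzero \<open>g\<close>. Nonzero eigenspaces of \<open>T\<close> are infinite-dimensional, since they
  are stable under multiplication by \<open>z\<^sub>1\<^sup>m\<close>, so a finite-dimensional kernel is trivial.
\<close>

section \<open>Functions of two complex variables on the bidisc\<close>

lemma continuous_on_slice_fst:
  assumes "continuous_on (A \<times> B) F" "c \<in> B"
  shows "continuous_on A (\<lambda>z. F (z, c))"
  by (rule continuous_on_compose2[OF assms(1)]) (use assms(2) in \<open>auto intro!: continuous_intros\<close>)

lemma continuous_on_slice_snd: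
  assumes "continuous_on (A \<times> B) F" "c \<in> A"
  shows "continuous_on B (\<lambda>z. F (c, z))"
  by (rule continuous_on_compose2[OF assms(1)]) (use assms(2) in \<open>auto intro!: continuous_intros\<close>)

text \<open>Nearby slices of a continuous function on a compact product are uniformly close. All
  passages from the open to the closed disc in one of the variables rest on this.\<close>

lemma uniform_limit_slice:
  fixes F :: "'a::metric_space \<times> 'b::metric_space \<Rightarrow> 'c::metric_space"
  assumes cont: "continuous_on (A \<times> C) F" and "compact A" "compact C" and c: "c \<in> C"
  shows "uniform_limit A (\<lambda>y x. F (x, y)) (\<lambda>x. F (x, c)) (at c within C)"
proof (rule uniform_limitI)
  fix e :: real assume e: "e > 0"
  have "uniformly_continuous_on (A \<times> C) F"
    by (intro compact_uniformly_continuous cont compact_Times assms)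
  then obtain d where d: "d > 0"
    "\<And>x y. x \<in> A \<times> C \<Longrightarrow> y \<in> A \<times> C \<Longrightarrow> dist y x < d \<Longrightarrow> dist (F y) (F x) < e"
    unfolding uniformly_continuous_on_def using e by metis
  have "\<forall>\<^sub>F y in at c within C. dist y c < d \<and> y \<in> C"
    using d(1) by (auto simp: eventually_at intro!: exI[of _ d])
  then show "\<forall>\<^sub>F y in at c within C. \<forall>x\<in>A. dist (F (x, y)) (F (x, c)) < e"
    by eventually_elim (use d(2) c in \<open>auto simp: dist_Pair_Pair\<close>)
qed

lemma holomorphic2_on_slices:
  assumes "holomorphic2_on F (A \<times> B)" "open A" "open B"
  shows "c \<in> B \<Longrightarrow> (\<lambda>z. F (z, c)) holomorphic_on A"
    and "c \<in> A \<Longrightarrow> (\<lambda>z. F (c, z)) holomorphic_on B"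
proof -
  have der: "\<exists>a b. (F has_derivative (\<lambda>h. a * fst h + b * snd h)) (at z)" if "z \<in> A \<times> B" for z
    using assms that unfolding holomorphic2_on_def
    by (metis at_within_open open_Times)
  show "(\<lambda>z. F (z, c)) holomorphic_on A" if c: "c \<in> B"
    unfolding holomorphic_on_open[OF \<open>open A\<close>]
  proof
    fix z assume "z \<in> A"
    then obtain a b where ab: "(F has_derivative (\<lambda>h. a * fst h + b * snd h)) (at (z, c))"
      using der[of "(z, c)"] c by auto
    have "((\<lambda>t. (t, c)) has_derivative (\<lambda>h. (h, 0))) (at z)"
      by (auto intro!: derivative_eq_intros)
    from has_derivative_compose[OF this ab]
    show "\<exists>f'. ((\<lambda>z. F (z, c)) has_field_derivative f') (at z)"
      by (auto simp: has_field_derivative_def)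
  qed
  show "(\<lambda>z. F (c, z)) holomorphic_on B" if c: "c \<in> A"
    unfolding holomorphic_on_open[OF \<open>open B\<close>]
  proof
    fix z assume "z \<in> B"
    then obtain a b where ab: "(F has_derivative (\<lambda>h. a * fst h + b * snd h)) (at (c, z))"
      using der[of "(c, z)"] c by auto
    have "((\<lambda>t. (c, t)) has_derivative (\<lambda>h. (0, h))) (at z)"
      by (auto intro!: derivative_eq_intros)
    from has_derivative_compose[OF this ab]
    show "\<exists>f'. ((\<lambda>z. F (c, z)) has_field_derivative f') (at z)"
      by (auto simp: has_field_derivative_def)
  qed
qed

lemma continuous_on_swap:
  assumes "continuous_on (A \<times> B) F" shows "continuous_on (B \<times> A) (\<lambda>z. F (prod.swap z))"
  by (rule continuous_on_compose2[OF assms]) (auto intro!: continuous_intros simp: prod.swap_def)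

text \<open>A slice over a boundary point is a uniform limit of slices over interior points, so
  holomorphy survives.\<close>

lemma holomorphic_slice_closed:
  fixes F :: "complex \<times> complex \<Rightarrow> complex"
  assumes cont: "continuous_on (cball a r \<times> cball b s) F" and s: "s > 0"
    and hol: "\<And>c. c \<in> ball b s \<Longrightarrow> (\<lambda>z. F (z, c)) holomorphic_on ball a r"
    and c: "c \<in> cball b s"
  shows "(\<lambda>z. F (z, c)) holomorphic_on ball a r"
proof -
  have "uniform_limit (cball a r) (\<lambda>y x. F (x, y)) (\<lambda>x. F (x, c)) (at c within cball b s)"
    by (rule uniform_limit_slice[OF cont _ _ c]) auto
  then have lim: "uniform_limit (cball a r) (\<lambda>y x. F (x, y)) (\<lambda>x. F (x, c)) (at c within ball b s)"
    by (rule filterlim_mono[OF _ order_refl]) (auto intro!: at_le)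
  have nt: "at c within ball b s \<noteq> bot"
    using c s by (simp add: trivial_limit_within islimpt_ball)
  have ev: "\<forall>\<^sub>F y in at c within ball b s.
      continuous_on (cball a r) (\<lambda>x. F (x, y)) \<and> (\<lambda>x. F (x, y)) holomorphic_on ball a r"
    by (auto simp: eventually_at_filter intro!: always_eventually hol continuous_on_slice_fst[OF cont])
  show ?thesis
    by (rule holomorphic_uniform_limit[OF ev lim nt])
qed

text \<open>The difference quotient in the first variable, completed by the partial derivative on
  the line where the first coordinate is \<open>a\<close>. It serves twice: near an interior point
  it yields Osgood's lemma, and for \<open>a = 0\<close> it is the quotient by the first coordinate
  function.\<close>

definition diff_quot :: "(complex \<times> complex \<Rightarrow> complex) \<Rightarrow> complex \<Rightarrow> complex \<times> complex \<Rightarrow> complex" where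
  "diff_quot F a z = (if fst z = a then deriv (\<lambda>x. F (x, snd z)) a
                      else (F z - F (a, snd z)) / (fst z - a))"

lemma diff_quot_eq: "F z = F (a, snd z) + (fst z - a) * diff_quot F a z"
  by (cases z) (auto simp: diff_quot_def)

lemma diff_quot_slice:
  assumes "continuous_on (cball a r) (\<lambda>x. F (x, c))" "(\<lambda>x. F (x, c)) holomorphic_on ball a r" "r > 0"
  shows "(\<lambda>x. diff_quot F a (x, c)) holomorphic_on ball a r"
    and "continuous_on (cball a r) (\<lambda>x. diff_quot F a (x, c))"
proof -
  show hol: "(\<lambda>x. diff_quot F a (x, c)) holomorphic_on ball a r"
    using pole_lemma_open[OF assms(2) open_ball, of a] by (simp add: diff_quot_def cong: if_cong)
  have "continuous_on (cball a r - {a}) (\<lambda>x. diff_quot F a (x, c))"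
    unfolding diff_quot_def
    by (rule continuous_on_eq[of _ "\<lambda>x. (F (x, c) - F (a, c)) / (x - a)"])
      (auto intro!: continuous_intros continuous_on_subset[OF assms(1)])
  moreover have "openin (top_of_set (cball a r)) (ball a r)"
    by (metis ball_subset_cball open_ball open_subset)
  moreover have "openin (top_of_set (cball a r)) (cball a r - {a})"
    by (simp add: openin_delete)
  moreover have "ball a r \<union> (cball a r - {a}) = cball a r"
    using \<open>r > 0\<close> by auto
  ultimately show "continuous_on (cball a r) (\<lambda>x. diff_quot F a (x, c))"
    using continuous_on_Un_local_open[of "ball a r" "cball a r - {a}"] holomorphic_on_imp_continuous_on[OF hol]
    by simp
qed

lemma holomorphic_bound_from_sphere:
  assumes "f holomorphic_on ball a r" "continuous_on (cball a r) f" "r > 0"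
    and "\<And>z. z \<in> sphere a r \<Longrightarrow> cmod (f z) \<le> M" and "z \<in> cball a r"
  shows "cmod (f z) \<le> M"
  by (rule maximum_modulus_frontier[of f "cball a r"])
    (use assms in \<open>auto simp: frontier_def\<close>)

text \<open>The point is continuity on the line \<open>fst z = a\<close>. The difference of two
  slices of the quotient is holomorphic, so by the maximum principle it suffices to estimate it on
  the circle of radius \<open>r\<close>, where the denominator has modulus \<open>r\<close> and only
  the uniform closeness of slices of \<open>F\<close> is needed.\<close>

lemma continuous_on_diff_quot:
  assumes cont: "continuous_on (cball a r \<times> C) F" and r: "r > 0" and C: "compact C"
    and hol: "\<And>c. c \<in> C \<Longrightarrow> (\<lambda>x. F (x, c)) holomorphic_on ball a r"
  shows "continuous_on (cball a r \<times> C) (diff_quot F a)"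
proof -
  have slice: "(\<lambda>x. diff_quot F a (x, c)) holomorphic_on ball a r"
    "continuous_on (cball a r) (\<lambda>x. diff_quot F a (x, c))" if "c \<in> C" for c
    using diff_quot_slice[OF continuous_on_slice_fst[OF cont that] hol[OF that] r] by auto
  have lim: "uniform_limit (cball a r) (\<lambda>y x. diff_quot F a (x, y)) (\<lambda>x. diff_quot F a (x, c)) (at c within C)"
    if c: "c \<in> C" for c
  proof (rule uniform_limitI)
    fix e :: real assume e: "e > 0"
    have "\<forall>\<^sub>F y in at c within C. \<forall>x\<in>cball a r. dist (F (x, y)) (F (x, c)) < e * r / 4"
      using uniform_limitD[OF uniform_limit_slice[OF cont compact_cball C c], of "e * r / 4"] e r by simp
    moreover have "\<forall>\<^sub>F y in at c within C. y \<in> C"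
      by (simp add: eventually_at_filter)
    ultimately show "\<forall>\<^sub>F y in at c within C. \<forall>x\<in>cball a r. dist (diff_quot F a (x, y)) (diff_quot F a (x, c)) < e"
    proof eventually_elim
      case (elim y)
      have "cmod (diff_quot F a (x, y) - diff_quot F a (x, c)) \<le> e / 2" if x: "x \<in> cball a r" for x
      proof (rule holomorphic_bound_from_sphere[OF _ _ r _ x])
        show "(\<lambda>x. diff_quot F a (x, y) - diff_quot F a (x, c)) holomorphic_on ball a r"
          using slice elim c by (intro holomorphic_intros) auto
        show "continuous_on (cball a r) (\<lambda>x. diff_quot F a (x, y) - diff_quot F a (x, c))"
          using slice elim c by (intro continuous_intros) auto
        fix z assume z: "z \<in> sphere a r"
        then have za: "cmod (z - a) = r" "z \<noteq> a" using r by (auto simp: dist_norm norm_minus_commute)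
        have "cmod (F (z, y) - F (z, c)) \<le> e * r / 4" "cmod (F (a, y) - F (a, c)) \<le> e * r / 4"
          using elim(1) z r by (auto simp: dist_norm less_imp_le)
        then have "cmod ((F (z, y) - F (z, c)) - (F (a, y) - F (a, c))) \<le> e * r / 4 + e * r / 4"
          by (meson add_mono norm_triangle_ineq4 order_trans)
        moreover have "diff_quot F a (z, y) - diff_quot F a (z, c)
            = ((F (z, y) - F (z, c)) - (F (a, y) - F (a, c))) / (z - a)"
          using za by (simp add: diff_quot_def diff_divide_distrib)
        ultimately have "cmod (diff_quot F a (z, y) - diff_quot F a (z, c)) \<le> (e * r / 4 + e * r / 4) / r"
          using za r by (simp only: norm_divide) (intro divide_right_mono, auto)
        then show "cmod (diff_quot F a (z, y) - diff_quot F a (z, c)) \<le> e / 2"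
          using r by simp
      qed
      then show ?case using e by (force simp: dist_norm)
    qed
  qed
  show ?thesis
    unfolding continuous_on_iff
  proof (intro ballI allI impI)
    fix z e assume z: "z \<in> cball a r \<times> C" and e: "(e::real) > 0"
    obtain x c where zx: "z = (x, c)" "x \<in> cball a r" "c \<in> C" using z by auto
    have "\<forall>\<^sub>F y in at c within C. \<forall>x\<in>cball a r. dist (diff_quot F a (x, y)) (diff_quot F a (x, c)) < e / 2"
      using uniform_limitD[OF lim[OF zx(3)], of "e / 2"] e by simp
    then obtain d where d: "d > 0"
      "\<And>y x. y \<in> C \<Longrightarrow> dist y c < d \<Longrightarrow> x \<in> cball a r \<Longrightarrow> dist (diff_quot F a (x, y)) (diff_quot F a (x, c)) < e / 2"
      unfolding eventually_at by (metis dist_self e half_gt_zero)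
    obtain d' where d': "d' > 0"
      "\<And>y. y \<in> cball a r \<Longrightarrow> dist y x < d' \<Longrightarrow> dist (diff_quot F a (y, c)) (diff_quot F a (x, c)) < e / 2"
      using slice(2)[OF zx(3)] zx(2) e unfolding continuous_on_iff by (metis half_gt_zero)
    show "\<exists>d>0. \<forall>z'\<in>cball a r \<times> C. dist z' z < d \<longrightarrow> dist (diff_quot F a z') (diff_quot F a z) < e"
    proof (intro exI[of _ "min d d'"] conjI ballI impI)
      fix z' assume z': "z' \<in> cball a r \<times> C" "dist z' z < min d d'"
      obtain x' c' where x': "z' = (x', c')" by (cases z')
      have "dist c' c < d" "dist x' x < d'"
        using z'(2) dist_fst_le[of z' z] dist_snd_le[of z' z] by (auto simp: x' zx)
      then have "dist (diff_quot F a (x', c')) (diff_quot F a (x', c)) < e / 2"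
        "dist (diff_quot F a (x', c)) (diff_quot F a (x, c)) < e / 2"
        using d(2) d'(2) z'(1) by (auto simp: x')
      then show "dist (diff_quot F a z') (diff_quot F a z) < e"
        unfolding x' zx by (smt (verit) dist_triangle field_sum_of_halves)
    qed (use d d' in auto)
  qed
qed

text \<open>Osgood's lemma: a continuous, separately holomorphic function is complex differentiable.
  At \<open>(a, c)\<close> write \<open>F z = F (a, snd z) + (fst z - a) * H z\<close> with
  \<open>H\<close> the difference quotient. The first summand is differentiable because it depends
  on one variable only, the second because \<open>H\<close> is continuous at \<open>(a, c)\<close>.
  This makes membership in the bidisc algebra checkable one variable at a time.\<close>

lemma holomorphic2_on_bidiscI:
  assumes cont: "continuous_on closed_bidisc F"
    and hol1: "\<And>c. c \<in> ball 0 1 \<Longrightarrow> (\<lambda>z. F (z, c)) holomorphic_on ball 0 1"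
    and hol2: "\<And>c. c \<in> ball 0 1 \<Longrightarrow> (\<lambda>z. F (c, z)) holomorphic_on ball 0 1"
  shows "holomorphic2_on F open_bidisc"
proof (rule holomorphic2_onI)
  fix z :: "complex \<times> complex" assume z: "z \<in> open_bidisc"
  obtain a c where zac: "z = (a, c)" "a \<in> ball 0 1" "c \<in> ball 0 1" using z by auto
  \<comment> \<open>Any radius with \<open>cball a r\<close> inside the open disc will do.\<close>
  define r where "r = (1 - cmod a) / 2"
  have r: "r > 0" using zac by (simp add: r_def)
  have sub: "cball a r \<subseteq> ball 0 1"
  proof
    fix x assume "x \<in> cball a r"
    then have "cmod (x - a) \<le> r" by (simp add: dist_norm norm_minus_commute)
    then show "x \<in> ball 0 1"
      using norm_triangle_ineq[of "x - a" a] zac by (simp add: r_def field_simps)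
  qed
  define H where "H = diff_quot F a"
  have "continuous_on (cball a r \<times> cball 0 1) H"
    unfolding H_def
  proof (rule continuous_on_diff_quot[OF _ r compact_cball])
    show "continuous_on (cball a r \<times> cball 0 1) F"
      by (rule continuous_on_subset[OF cont]) (use sub in auto)
    show "(\<lambda>x. F (x, y)) holomorphic_on ball a r" if "y \<in> cball 0 1" for y
      by (rule holomorphic_on_subset[OF holomorphic_slice_closed[OF cont _ hol1 that]]) (use sub in auto)
  qed
  then have "continuous_on (ball a r \<times> ball 0 1) H"
    by (rule continuous_on_subset) auto
  then have contH: "(H \<longlongrightarrow> H (a, c)) (at (a, c))"
    using zac r by (simp add: continuous_on_eq_continuous_at open_Times isCont_def)
  obtain b where b: "((\<lambda>y. F (a, y)) has_field_derivative b) (at c)"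
    using hol2[OF zac(2)] zac(3) unfolding holomorphic_on_open[OF open_ball] by blast
  have "((\<lambda>z. F (a, snd z)) has_derivative (\<lambda>h. b * snd h)) (at (a, c))"
    using has_derivative_compose[OF has_derivative_snd[OF has_derivative_ident, of "at (a, c)"], of "\<lambda>y. F (a, y)" "(*) b"] b
    by (simp add: has_field_derivative_def)
  moreover have "((\<lambda>z. (fst z - a) * H z) has_derivative (\<lambda>h. H (a, c) * fst h)) (at (a, c))"
    unfolding has_derivative_iff_norm
  proof
    show "bounded_linear (\<lambda>h. H (a, c) * fst h)"
      by (intro bounded_linear_const_mult bounded_linear_fst)
    have "((\<lambda>y. norm (H y - H (a, c))) \<longlongrightarrow> 0) (at (a, c))"
      using contH by (simp add: tendsto_norm_zero LIM_zero)
    then show "((\<lambda>y. norm ((fst y - a) * H y - (fst (a, c) - a) * H (a, c) - H (a, c) * fst (y - (a, c)))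
        / norm (y - (a, c))) \<longlongrightarrow> 0) (at (a, c))"
    proof (rule tendsto_sandwich[OF _ _ tendsto_const, rotated 2])
      show "\<forall>\<^sub>F y in at (a, c). norm ((fst y - a) * H y - (fst (a, c) - a) * H (a, c) - H (a, c) * fst (y - (a, c)))
        / norm (y - (a, c)) \<le> norm (H y - H (a, c))"
      proof (rule always_eventually, rule allI)
        fix y
        have "norm ((fst y - a) * H y - (fst (a, c) - a) * H (a, c) - H (a, c) * fst (y - (a, c)))
            = norm (fst (y - (a, c))) * norm (H y - H (a, c))"
          by (simp add: norm_mult[symmetric] algebra_simps)
        also have "\<dots> \<le> norm (y - (a, c)) * norm (H y - H (a, c))"
          by (intro mult_right_mono norm_ge_zero) (metis norm_fst_le prod.collapse)
        finally show "norm ((fst y - a) * H y - (fst (a, c) - a) * H (a, c) - H (a, c) * fst (y - (a, c)))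
            / norm (y - (a, c)) \<le> norm (H y - H (a, c))"
          by (cases "y = (a, c)") (auto simp: field_simps)
      qed
    qed auto
  qed
  ultimately have "((\<lambda>z. F (a, snd z) + (fst z - a) * H z) has_derivative (\<lambda>h. b * snd h + H (a, c) * fst h)) (at (a, c))"
    by (rule has_derivative_add)
  moreover have "(\<lambda>z. F (a, snd z) + (fst z - a) * H z) = F"
    unfolding H_def by (rule ext) (rule diff_quot_eq[symmetric])
  ultimately have "(F has_derivative (\<lambda>h. H (a, c) * fst h + b * snd h)) (at z)"
    by (simp add: zac add.commute)
  then show "\<exists>a b. (F has_derivative (\<lambda>h. a * fst h + b * snd h)) (at z within open_bidisc)"
    by (blast intro: has_derivative_at_withinI)
qed

text \<open>The maximum principle applied in one variable after the other: the torus is the Shilov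
  boundary.\<close>

lemma bidisc_bound_from_torus:
  assumes cont: "continuous_on closed_bidisc F"
    and hol1: "\<And>c. c \<in> cball 0 1 \<Longrightarrow> (\<lambda>z. F (z, c)) holomorphic_on ball 0 1"
    and hol2: "\<And>c. c \<in> cball 0 1 \<Longrightarrow> (\<lambda>z. F (c, z)) holomorphic_on ball 0 1"
    and M: "\<And>z. z \<in> torus \<Longrightarrow> cmod (F z) \<le> M" and z: "z \<in> closed_bidisc"
  shows "cmod (F z) \<le> M"
proof -
  obtain x y where xy: "z = (x, y)" "x \<in> cball 0 1" "y \<in> cball 0 1" using z by auto
  have 1: "cmod (F (s, y)) \<le> M" if "s \<in> sphere 0 1" for s
    by (rule holomorphic_bound_from_sphere[of "\<lambda>y. F (s, y)" 0 1])
      (use that xy M in \<open>auto intro!: hol2 continuous_on_slice_snd[OF cont]\<close>)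
  show ?thesis unfolding xy
    by (rule holomorphic_bound_from_sphere[of "\<lambda>x. F (x, y)" 0 1])
      (use xy 1 in \<open>auto intro!: hol1 continuous_on_slice_fst[OF cont]\<close>)
qed

text \<open>Zeros of a function of two variables are not isolated. If the slice through
  \<open>t\<close> does not vanish identically, it is bounded away from zero on a small circle
  around \<open>snd t\<close>, and so are all nearby slices. A nearby slice without a zero inside
  the circle would have a reciprocal obeying the maximum principle, which contradicts its small
  value at \<open>snd t\<close>. So there is a zero over every first coordinate near \<open>fst
  t\<close>.\<close>

lemma infinite_zeros_fst:
  assumes cont: "continuous_on closed_bidisc F"
    and hol: "\<And>c. c \<in> cball 0 1 \<Longrightarrow> (\<lambda>z. F (c, z)) holomorphic_on ball 0 1"
    and t: "t \<in> cball 0 1 \<times> ball 0 1" and zero: "F t = 0"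
  shows "infinite {z \<in> closed_bidisc. F z = 0}"
proof -
  obtain a b where ab: "t = (a, b)" "a \<in> cball 0 1" "b \<in> ball 0 1" using t by auto
  have inf: "infinite (ball x e)" if "e > 0" for x :: complex and e
    using that finite_imp_not_open[of "ball x e"] by auto
  show ?thesis
  proof (cases "\<forall>y\<in>ball 0 1. F (a, y) = 0")
    case True
    then have "Pair a ` ball 0 1 \<subseteq> {z \<in> closed_bidisc. F z = 0}" using ab by auto
    moreover have "infinite (Pair a ` (ball 0 1 :: complex set))"
      using inf[of 1 0] by (metis finite_imageD inj_on_def prod.inject zero_less_one)
    ultimately show ?thesis using finite_subset by blast
  next
    case False
    then obtain b' where b': "b' \<in> ball 0 1" "F (a, b') \<noteq> 0" by auto
    obtain s where s: "0 < s" "ball b s \<subseteq> ball 0 1" "\<And>z. z \<in> ball b s - {b} \<Longrightarrow> F (a, z) \<noteq> 0"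
      using isolated_zeros[OF hol[OF ab(2)] open_ball connected_ball ab(3) _ b'] zero ab by metis
    define r where "r = s / 2"
    have r: "r > 0" "cball b r \<subseteq> ball 0 1" using s by (auto simp: r_def)
    have nz: "F (a, z) \<noteq> 0" if "z \<in> sphere b r" for z
      using s that r(1) by (intro s(3)) (auto simp: r_def)
    have cr: "continuous_on (cball b r) (\<lambda>y. F (x, y))" if "x \<in> cball 0 1" for x
      by (rule continuous_on_subset[OF continuous_on_slice_snd[OF cont that]]) (use r in auto)
    have "continuous_on (sphere b r) (\<lambda>y. cmod (F (a, y)))"
      by (intro continuous_on_norm continuous_on_subset[OF cr[OF ab(2)]]) auto
    moreover have "sphere b r \<noteq> {}" using r by simp
    ultimately obtain z0 where z0: "z0 \<in> sphere b r" "\<And>z. z \<in> sphere b r \<Longrightarrow> cmod (F (a, z0)) \<le> cmod (F (a, z))"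
      using continuous_attains_inf[OF compact_sphere] by meson
    define d where "d = cmod (F (a, z0))"
    have d: "d > 0" using nz z0 by (simp add: d_def)
    have "uniform_limit (cball 0 1) (\<lambda>x y. F (x, y)) (\<lambda>y. F (a, y)) (at a within cball 0 1)"
      using uniform_limit_slice[OF continuous_on_swap[OF cont] compact_cball compact_cball ab(2)] by simp
    then have "\<forall>\<^sub>F x in at a within cball 0 1. \<forall>y\<in>cball 0 1. dist (F (x, y)) (F (a, y)) < d / 2"
      using d by (intro uniform_limitD) auto
    then obtain e where e: "e > 0"
      "\<And>x y. x \<in> cball 0 1 \<Longrightarrow> dist x a < e \<Longrightarrow> y \<in> cball 0 1 \<Longrightarrow> dist (F (x, y)) (F (a, y)) < d / 2"
      unfolding eventually_at using d by (metis dist_self half_gt_zero)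
    have ex: "\<exists>y\<in>cball b r. F (x, y) = 0" if x: "x \<in> cball 0 1" "dist x a < e" for x
    proof (rule ccontr)
      assume "\<not> (\<exists>y\<in>cball b r. F (x, y) = 0)"
      then have nz: "F (x, y) \<noteq> 0" if "y \<in> cball b r" for y using that by auto
      have "cmod (1 / F (x, b)) \<le> 2 / d"
      proof (rule holomorphic_bound_from_sphere[of "\<lambda>y. 1 / F (x, y)" b r])
        show "(\<lambda>y. 1 / F (x, y)) holomorphic_on ball b r"
          using r nz by (intro holomorphic_intros holomorphic_on_subset[OF hol[OF x(1)]]) auto
        show "continuous_on (cball b r) (\<lambda>y. 1 / F (x, y))"
          using nz by (intro continuous_intros cr x) auto
        fix y assume y: "y \<in> sphere b r"
        have "d \<le> cmod (F (a, y))" using z0(2)[OF y] by (simp add: d_def)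
        moreover have "cmod (F (x, y) - F (a, y)) < d / 2"
          using e(2)[OF x, of y] r y by (force simp: dist_norm)
        moreover have "cmod (F (a, y)) \<le> cmod (F (x, y)) + cmod (F (x, y) - F (a, y))"
          by (metis norm_minus_commute norm_triangle_sub)
        ultimately have "d / 2 \<le> cmod (F (x, y))" by linarith
        then show "cmod (1 / F (x, y)) \<le> 2 / d"
          using d by (simp add: norm_divide divide_simps)
      qed (use r in auto)
      then have "d \<le> 2 * cmod (F (x, b))"
        using d nz[of b] r by (simp add: norm_divide field_simps)
      moreover have "cmod (F (x, b)) < d / 2"
        using e(2)[OF x, of b] ab zero by (simp add: dist_norm)
      ultimately show False by simp
    qed
    have "infinite (ball a e \<inter> cball 0 1)"
    proof -
      have "a \<in> closure (ball 0 1)" using ab(2) by simp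
      then obtain y where "y \<in> ball 0 1" "dist y a < e"
        using e(1) unfolding closure_approachable by blast
      then have "ball a e \<inter> ball 0 1 \<noteq> {}" by (force simp: dist_commute)
      then have "infinite (ball a e \<inter> ball 0 1)"
        using finite_imp_not_open[OF _ open_Int[OF open_ball open_ball]] by blast
      then show ?thesis
        by (rule infinite_super[rotated]) auto
    qed
    moreover have "ball a e \<inter> cball 0 1 \<subseteq> fst ` {z \<in> closed_bidisc. F z = 0}"
    proof
      fix x assume x: "x \<in> ball a e \<inter> cball 0 1"
      then obtain y where "y \<in> cball b r" "F (x, y) = 0" using ex[of x] by (auto simp: dist_commute)
      then show "x \<in> fst ` {z \<in> closed_bidisc. F z = 0}"
        using x r by (intro image_eqI[of _ _ "(x, y)"]) auto
    qed
    ultimately show ?thesis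
      using finite_subset by blast
  qed
qed

section \<open>The bidisc algebra as an integral domain\<close>

lemma bd_holomorphic_slice:
  assumes "c \<in> cball 0 1"
  shows "(\<lambda>z. bd_apply f (z, c)) holomorphic_on ball 0 1"
    and "(\<lambda>z. bd_apply f (c, z)) holomorphic_on ball 0 1"
proof -
  note sl = holomorphic2_on_slices[OF bd_apply_props(2)[of f] open_ball open_ball]
  show "(\<lambda>z. bd_apply f (z, c)) holomorphic_on ball 0 1"
    by (rule holomorphic_slice_closed[OF bd_apply_props(1) _ sl(1) assms]) auto
  show "(\<lambda>z. bd_apply f (c, z)) holomorphic_on ball 0 1"
    using holomorphic_slice_closed[OF continuous_on_swap[OF bd_apply_props(1)] _ _ assms, of f] sl(2)
    by simp
qed

text \<open>Elements of the bidisc algebra vanish outside the closed bidisc as HOL functions;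
  \<open>bd_of\<close> cuts a function off accordingly. Only its values for continuous, separately
  holomorphic arguments are meaningful.\<close>

definition bd_of :: "(complex \<times> complex \<Rightarrow> complex) \<Rightarrow> bidisc_algebra" where
  "bd_of F = Bidisc (\<lambda>z. if z \<in> closed_bidisc then F z else 0)"

lemma bd_apply_bd_of:
  assumes cont: "continuous_on closed_bidisc F"
    and hol1: "\<And>c. c \<in> ball 0 1 \<Longrightarrow> (\<lambda>z. F (z, c)) holomorphic_on ball 0 1"
    and hol2: "\<And>c. c \<in> ball 0 1 \<Longrightarrow> (\<lambda>z. F (c, z)) holomorphic_on ball 0 1"
    and z: "z \<in> closed_bidisc"
  shows "bd_apply (bd_of F) z = F z"
proof -
  define G where "G = (\<lambda>z. if z \<in> closed_bidisc then F z else 0)"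
  have "continuous_on closed_bidisc G"
    by (rule continuous_on_eq[OF cont]) (simp add: G_def)
  moreover have "holomorphic2_on G open_bidisc"
  proof (rule holomorphic2_on_bidiscI)
    show "continuous_on closed_bidisc G" by fact
    show "(\<lambda>z. G (z, c)) holomorphic_on ball 0 1" if "c \<in> ball 0 1" for c
      by (rule holomorphic_transform[OF hol1[OF that]]) (use that in \<open>auto simp: G_def\<close>)
    show "(\<lambda>z. G (c, z)) holomorphic_on ball 0 1" if "c \<in> ball 0 1" for c
      by (rule holomorphic_transform[OF hol2[OF that]]) (use that in \<open>auto simp: G_def\<close>)
  qed
  ultimately have "bd_apply (bd_of F) = G"
    unfolding bd_of_def G_def[symmetric] by (intro Bidisc_inverse) (auto simp: G_def)
  then show ?thesis using z by (simp add: G_def)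
qed

instantiation bidisc_algebra :: comm_ring_1
begin

definition one_bidisc_algebra :: bidisc_algebra where "1 = bd_of (\<lambda>z. 1)"

definition times_bidisc_algebra :: "bidisc_algebra \<Rightarrow> bidisc_algebra \<Rightarrow> bidisc_algebra" where
  "f * g = bd_of (\<lambda>z. bd_apply f z * bd_apply g z)"

lemma bd_apply_one [simp]: "z \<in> closed_bidisc \<Longrightarrow> bd_apply 1 z = 1"
  unfolding one_bidisc_algebra_def by (rule bd_apply_bd_of) (auto intro!: continuous_intros)

lemma bd_apply_times [simp]: "bd_apply (f * g) z = bd_apply f z * bd_apply g z"
proof (cases "z \<in> closed_bidisc")
  case True
  show ?thesis unfolding times_bidisc_algebra_def
    by (rule bd_apply_bd_of)
      (use True in \<open>auto intro!: continuous_intros bd_apply_props holomorphic_intros bd_holomorphic_slice\<close>)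
qed (simp add: bd_apply_props(3))

instance
proof
  show "(0::bidisc_algebra) \<noteq> 1"
  proof
    assume "(0::bidisc_algebra) = 1"
    then have "bd_apply 0 (0, 0) = bd_apply 1 (0, 0)" by simp
    then show False by simp
  qed
qed (rule bd_eqI; simp add: algebra_simps)+

end

lemma scaleC_times_left [simp]: "(c *\<^sub>C f) * g = c *\<^sub>C (f * g)" for f g :: bidisc_algebra
  by (rule bd_eqI) (simp add: algebra_simps)

lemma scaleC_times_right [simp]: "f * (c *\<^sub>C g) = c *\<^sub>C (f * g)" for f g :: bidisc_algebra
  by (rule bd_eqI) (simp add: algebra_simps)

lemma bd_apply_power [simp]: "z \<in> closed_bidisc \<Longrightarrow> bd_apply (f ^ n) z = bd_apply f z ^ n"
  by (induction n) auto

lemma bd_apply_sum [simp]: "bd_apply (sum f A) z = (\<Sum>x\<in>A. bd_apply (f x) z)"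
  by (induction A rule: infinite_finite_induct) auto

lemma norm_times_bd: "norm (f * g) \<le> norm f * norm (g :: bidisc_algebra)"
  by (rule bd_norm_least) (simp add: norm_mult mult_mono bd_norm_upper)

lemma bd_norm_torus_least:
  assumes "\<And>z. z \<in> torus \<Longrightarrow> cmod (bd_apply f z) \<le> M"
  shows "norm f \<le> M"
  by (rule bd_norm_least, rule bidisc_bound_from_torus)
    (use assms in \<open>auto intro!: bd_apply_props bd_holomorphic_slice\<close>)

lemma bd_unit:
  assumes "\<And>z. z \<in> closed_bidisc \<Longrightarrow> bd_apply g z \<noteq> 0"
  shows "\<exists>h. g * h = 1"
proof
  have "bd_apply (bd_of (\<lambda>z. 1 / bd_apply g z)) z = 1 / bd_apply g z" if "z \<in> closed_bidisc" for z
    by (rule bd_apply_bd_of)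
      (use that assms in \<open>auto intro!: continuous_intros bd_apply_props holomorphic_intros bd_holomorphic_slice\<close>)
  then show "g * bd_of (\<lambda>z. 1 / bd_apply g z) = 1"
    by (intro bd_eqI) (use assms in simp)
qed

text \<open>The open bidisc is dense in the closed one.\<close>

lemma bd_nonzero_interior:
  assumes "f \<noteq> 0"
  obtains z where "z \<in> open_bidisc" "bd_apply f z \<noteq> 0"
proof -
  have cl: "closure open_bidisc = (closed_bidisc :: (complex \<times> complex) set)"
    by (simp add: closure_Times)
  have "f = 0" if "\<forall>z\<in>open_bidisc. bd_apply f z = 0"
  proof (rule bd_eqI)
    fix z :: "complex \<times> complex" assume "z \<in> closed_bidisc"
    then have "z \<in> closure open_bidisc" unfolding cl .
    then show "bd_apply f z = bd_apply 0 z"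
      using continuous_constant_on_closure[of open_bidisc "bd_apply f" 0 z] bd_apply_props(1)[of f] that
      unfolding cl by simp
  qed
  then show ?thesis using assms that by blast
qed

text \<open>If \<open>f\<close> is nonzero somewhere, it is nonzero on a small open box, where
  \<open>g\<close> must then vanish. The identity theorem, first in the first and then in the second
  variable, spreads this to the whole bidisc.\<close>

instance bidisc_algebra :: idom
proof
  fix f g :: bidisc_algebra assume fg: "f \<noteq> 0" "g \<noteq> 0"
  show "f * g \<noteq> 0"
  proof
    assume fg0: "f * g = 0"
    obtain a b where ab: "(a, b) \<in> open_bidisc" "bd_apply f (a, b) \<noteq> 0"
      using bd_nonzero_interior[OF fg(1)] by (metis prod.collapse)
    have contf: "continuous_on open_bidisc (bd_apply f)"
      by (rule continuous_on_subset[OF bd_apply_props(1)]) auto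
    have "open (open_bidisc \<inter> bd_apply f -` (- {0}))"
      by (rule continuous_open_preimage[OF contf open_open_bidisc]) auto
    then obtain A B where AB: "open A" "open B" "a \<in> A" "b \<in> B"
      "A \<times> B \<subseteq> open_bidisc \<inter> bd_apply f -` (- {0})"
      using ab by (elim open_prod_elim[of _ "(a, b)"]) auto
    have g0: "bd_apply g (x, y) = 0" if "x \<in> A" "y \<in> B" for x y
    proof -
      have "bd_apply (f * g) (x, y) = 0" using fg0 by simp
      moreover have "bd_apply f (x, y) \<noteq> 0" using AB(5) that by blast
      ultimately show ?thesis by simp
    qed
    have sub: "A \<subseteq> ball 0 1" "B \<subseteq> ball 0 1" using AB by auto
    have 1: "bd_apply g (x, y) = 0" if "x \<in> ball 0 1" "y \<in> B" for x y
      by (rule analytic_continuation[of "\<lambda>x. bd_apply g (x, y)" "ball 0 1" A a])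
        (use that sub AB g0 in \<open>auto intro!: bd_holomorphic_slice interior_limit_point simp: interior_open subset_iff less_imp_le\<close>)
    have 2: "bd_apply g (x, y) = 0" if "x \<in> ball 0 1" "y \<in> ball 0 1" for x y
      by (rule analytic_continuation[of "\<lambda>y. bd_apply g (x, y)" "ball 0 1" B b])
        (use that sub AB 1 in \<open>auto intro!: bd_holomorphic_slice interior_limit_point simp: interior_open subset_iff less_imp_le\<close>)
    show False
      using bd_nonzero_interior[OF fg(2)] 2 by (metis mem_Times_iff prod.collapse)
  qed
qed

section \<open>Dilations, coordinates and division by a coordinate\<close>

text \<open>Composition with a diagonal linear map of the bidisc. Unimodular parameters give the
  rotations; the parameters \<open>0, 1\<close> and \<open>1, 0\<close> give restriction to a
  coordinate axis, extended constantly in the other variable. Treating both as one family makes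
  their commutation immediate.\<close>

definition dilate :: "complex \<Rightarrow> complex \<Rightarrow> bidisc_algebra \<Rightarrow> bidisc_algebra" where
  "dilate a b f = bd_of (\<lambda>z. bd_apply f (a * fst z, b * snd z))"

lemma mult_mem_disc:
  fixes a z :: complex
  assumes "cmod a \<le> 1"
  shows "z \<in> ball 0 1 \<Longrightarrow> a * z \<in> ball 0 1" "z \<in> cball 0 1 \<Longrightarrow> a * z \<in> cball 0 1"
proof -
  have "cmod (a * z) \<le> cmod z" using assms by (simp add: norm_mult mult_left_le_one_le)
  then show "z \<in> ball 0 1 \<Longrightarrow> a * z \<in> ball 0 1" "z \<in> cball 0 1 \<Longrightarrow> a * z \<in> cball 0 1" by auto
qed

lemma bd_apply_dilate [simp]:
  assumes "cmod a \<le> 1" "cmod b \<le> 1" "z \<in> closed_bidisc"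
  shows "bd_apply (dilate a b f) z = bd_apply f (a * fst z, b * snd z)"
  unfolding dilate_def
proof (rule bd_apply_bd_of)
  note disc = mult_mem_disc[OF assms(1)] mult_mem_disc[OF assms(2)]
  show "continuous_on closed_bidisc (\<lambda>z. bd_apply f (a * fst z, b * snd z))"
    by (rule continuous_on_compose2[OF bd_apply_props(1)]) (use disc in \<open>auto intro!: continuous_intros\<close>)
  fix c :: complex assume c: "c \<in> ball 0 1"
  have "(\<lambda>z. bd_apply f (z, b * c)) \<circ> (\<lambda>z. a * z) holomorphic_on ball 0 1"
    by (rule holomorphic_on_compose_gen[OF _ bd_holomorphic_slice(1)[of "b * c"]])
      (use disc c in \<open>auto intro!: holomorphic_intros\<close>)
  then show "(\<lambda>z. bd_apply f (a * fst (z, c), b * snd (z, c))) holomorphic_on ball 0 1"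
    by (simp add: o_def)
  have "(\<lambda>z. bd_apply f (a * c, z)) \<circ> (\<lambda>z. b * z) holomorphic_on ball 0 1"
    by (rule holomorphic_on_compose_gen[OF _ bd_holomorphic_slice(2)[of "a * c"]])
      (use disc c in \<open>auto intro!: holomorphic_intros\<close>)
  then show "(\<lambda>z. bd_apply f (a * fst (c, z), b * snd (c, z))) holomorphic_on ball 0 1"
    by (simp add: o_def)
qed (use assms in auto)

definition bd_swap :: "bidisc_algebra \<Rightarrow> bidisc_algebra" where
  "bd_swap f = bd_of (\<lambda>z. bd_apply f (prod.swap z))"

lemma bd_apply_swap [simp]:
  "z \<in> closed_bidisc \<Longrightarrow> bd_apply (bd_swap f) z = bd_apply f (prod.swap z)"
  unfolding bd_swap_def
  by (rule bd_apply_bd_of) (auto intro!: continuous_on_swap bd_apply_props bd_holomorphic_slice)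

definition coord1 :: bidisc_algebra where "coord1 = bd_of fst"
definition coord2 :: bidisc_algebra where "coord2 = bd_of snd"

lemma bd_apply_coord [simp]:
  assumes "z \<in> closed_bidisc"
  shows "bd_apply coord1 z = fst z" "bd_apply coord2 z = snd z"
  unfolding coord1_def coord2_def
  by (rule bd_apply_bd_of; use assms in \<open>auto intro!: continuous_intros\<close>)+

text \<open>The coordinates are unimodular on the torus, so multiplication by them is
  isometric.\<close>

lemma norm_coord_times:
  shows "norm (coord1 * f) = norm f" "norm (coord2 * f) = norm f"
proof -
  have t: "cmod (bd_apply f z) \<le> norm (coord1 * f)" "cmod (bd_apply f z) \<le> norm (coord2 * f)"
    if "z \<in> torus" for z
    using that bd_norm_upper[of z "coord1 * f"] bd_norm_upper[of z "coord2 * f"]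
    by (auto simp: norm_mult)
  have u: "norm (coord1 * f) \<le> norm f" "norm (coord2 * f) \<le> norm f"
    using bd_norm_upper[of _ f] by (auto intro!: bd_norm_torus_least simp: norm_mult)
  show "norm (coord1 * f) = norm f" "norm (coord2 * f) = norm f"
    using u by (auto intro!: antisym bd_norm_torus_least t)
qed

text \<open>The kernel of the restriction to the axis \<open>fst z = 0\<close> is the ideal
  generated by the first coordinate. The quotient is the difference quotient at \<open>0\<close>.
  Its slices in the second variable are visibly holomorphic except over \<open>0\<close>, and the
  slice over \<open>0\<close> is a uniform limit of the others.\<close>

lemma coord1_dvd:
  assumes "dilate 0 1 u = 0"
  shows "coord1 dvd u"
proof -
  define H where "H = diff_quot (bd_apply u) 0"
  have u0: "bd_apply u (0, y) = 0" if "y \<in> cball 0 1" for y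
    using bd_apply_dilate[of 0 1 "(0, y)" u] that assms by simp
  have cont: "continuous_on closed_bidisc H"
    unfolding H_def by (rule continuous_on_diff_quot) (auto intro!: bd_apply_props bd_holomorphic_slice)
  have hol1: "(\<lambda>z. H (z, c)) holomorphic_on ball 0 1" if "c \<in> cball 0 1" for c
    unfolding H_def
    by (rule diff_quot_slice(1)) (use that in \<open>auto intro!: bd_holomorphic_slice continuous_on_slice_fst[OF bd_apply_props(1)]\<close>)
  have hol2: "(\<lambda>z. H (c, z)) holomorphic_on ball 0 1" if c: "c \<in> cball 0 1" "c \<noteq> 0" for c
    by (rule holomorphic_transform[of "\<lambda>z. (bd_apply u (c, z) - bd_apply u (0, z)) / c"])
      (use c in \<open>auto intro!: holomorphic_intros bd_holomorphic_slice simp: H_def diff_quot_def\<close>)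
  have hol0: "(\<lambda>z. H (0, z)) holomorphic_on ball 0 1"
  proof (rule holomorphic_uniform_limit)
    show "uniform_limit (cball 0 1) (\<lambda>x y. H (x, y)) (\<lambda>y. H (0, y)) (at 0 within cball 0 1)"
      using uniform_limit_slice[OF continuous_on_swap[OF cont] compact_cball compact_cball, of 0] by simp
    show "\<forall>\<^sub>F x in at 0 within cball 0 1. continuous_on (cball 0 1) (\<lambda>y. H (x, y)) \<and> (\<lambda>y. H (x, y)) holomorphic_on ball 0 1"
      by (auto simp: eventually_at_filter intro!: always_eventually hol2 continuous_on_slice_snd[OF cont])
    show "at 0 within cball 0 1 \<noteq> (bot :: complex filter)"
      using islimpt_subset[of 0 "ball 0 1 :: complex set" "cball 0 1"] by (simp add: trivial_limit_within islimpt_ball subset_iff)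
  qed
  have H: "bd_apply (bd_of H) z = H z" if "z \<in> closed_bidisc" for z
  proof (rule bd_apply_bd_of[OF cont _ _ that])
    show "(\<lambda>z. H (c, z)) holomorphic_on ball 0 1" if "c \<in> ball 0 1" for c
      using hol0 hol2[of c] that by (cases "c = 0") auto
  qed (use hol1 in auto)
  have "u = coord1 * bd_of H"
  proof (rule bd_eqI)
    fix z :: "complex \<times> complex" assume z: "z \<in> closed_bidisc"
    have "bd_apply u z = fst z * H z"
      using diff_quot_eq[of "bd_apply u" z 0] u0[of "snd z"] z by (auto simp: H_def)
    then show "bd_apply u z = bd_apply (coord1 * bd_of H) z" using z H[OF z] by simp
  qed
  then show ?thesis by (rule dvdI)
qed

lemma coord2_dvd:
  assumes "dilate 1 0 u = 0"
  shows "coord2 dvd u"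
proof -
  have "bd_apply u (x, 0) = 0" if "x \<in> cball 0 1" for x
    using bd_apply_dilate[of 1 0 "(x, 0)" u] that assms by simp
  then have "dilate 0 1 (bd_swap u) = 0" by (intro bd_eqI) auto
  then obtain v where v: "bd_swap u = coord1 * v" using coord1_dvd by (auto elim: dvdE)
  have "u = coord2 * bd_swap v"
  proof (rule bd_eqI)
    fix z :: "complex \<times> complex" assume z: "z \<in> closed_bidisc"
    then have z': "prod.swap z \<in> closed_bidisc" by auto
    have "bd_apply u z = bd_apply (bd_swap u) (prod.swap z)" using z' by simp
    then show "bd_apply u z = bd_apply (coord2 * bd_swap v) z" using z z' by (simp add: v)
  qed
  then show ?thesis by (rule dvdI)
qed

section \<open>Zeros of elements of the bidisc algebra and multiplication operators\<close>

lemma infinite_zeros: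
  assumes "t \<in> closed_bidisc" "t \<notin> torus" "bd_apply g t = 0"
  shows "infinite {z \<in> closed_bidisc. bd_apply g z = 0}"
proof (cases "snd t \<in> ball 0 1")
  case True
  then show ?thesis
    by (intro infinite_zeros_fst[of _ t])
      (use assms in \<open>auto intro!: bd_apply_props bd_holomorphic_slice simp: mem_Times_iff\<close>)
next
  case False
  have "infinite {z \<in> closed_bidisc. bd_apply g (prod.swap z) = 0}"
    by (rule infinite_zeros_fst[of _ "prod.swap t"])
      (use assms False in \<open>auto intro!: continuous_on_swap bd_apply_props bd_holomorphic_slice simp: mem_Times_iff\<close>)
  moreover have "{z \<in> closed_bidisc. bd_apply g (prod.swap z) = 0}
      = prod.swap ` {z \<in> closed_bidisc. bd_apply g z = 0}"
    by (auto intro!: image_eqI[of _ prod.swap "prod.swap _"])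
  ultimately have "infinite (prod.swap ` {z \<in> closed_bidisc. bd_apply g z = 0})" by simp
  then show ?thesis by blast
qed

text \<open>The function \<open>P\<close> below peaks at \<open>t\<close>: it equals
  \<open>1\<close> there and has smaller modulus elsewhere. High powers of \<open>P\<close> have
  norm one and are concentrated where \<open>g\<close> is small.\<close>

lemma times_not_bounded_below:
  assumes t: "t \<in> torus" and g: "bd_apply g t = 0" and e: "e > 0"
  shows "\<exists>f. norm f = 1 \<and> norm (g * f) < e"
proof -
  obtain a b where ab: "t = (a, b)" "cmod a = 1" "cmod b = 1" using t by auto
  define P where "P = ((1 / 4) *\<^sub>C ((1 + cnj a *\<^sub>C coord1) * (1 + cnj b *\<^sub>C coord2)))"
  have half: "cmod (1 + cnj a * z) \<le> 2" "cmod (1 + cnj a * z) = 2 \<Longrightarrow> z = a"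
    if "cmod a = 1" "cmod z \<le> 1" for a z
  proof -
    have le: "cmod (cnj a * z) \<le> 1" using that by (simp add: norm_mult)
    then show "cmod (1 + cnj a * z) \<le> 2" using norm_triangle_ineq[of 1 "cnj a * z"] by simp
    assume eq: "cmod (1 + cnj a * z) = 2"
    define u where "u = cnj a * z"
    have "(cmod (1 + u))\<^sup>2 = 1 + 2 * Re u + (cmod u)\<^sup>2"
      unfolding cmod_power2 by (simp add: power2_eq_square algebra_simps)
    moreover have "(cmod u)\<^sup>2 \<le> 1" using le by (simp add: u_def power_le_one)
    ultimately have "Re u \<ge> 1" using eq by (simp add: u_def)
    moreover have "(Re u)\<^sup>2 + (Im u)\<^sup>2 \<le> 1" using \<open>(cmod u)\<^sup>2 \<le> 1\<close> by (simp add: cmod_power2)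
    moreover have "Re u \<le> 1" using complex_Re_le_cmod[of u] le by (simp add: u_def)
    ultimately have "u = 1" by (simp add: complex_eq_iff)
    then have "a * (cnj a * z) = a" by (simp add: u_def)
    moreover have "a * cnj a = 1" using that complex_norm_square[of a] by simp
    ultimately show "z = a" by (simp add: mult.assoc[symmetric])
  qed
  have Pz: "cmod (bd_apply P z) = cmod (1 + cnj a * fst z) * cmod (1 + cnj b * snd z) / 4"
    if "z \<in> closed_bidisc" for z
    using that by (simp add: P_def norm_mult)
  have Ple: "cmod (bd_apply P z) \<le> 1" if "z \<in> closed_bidisc" for z
  proof -
    have "cmod (1 + cnj a * fst z) * cmod (1 + cnj b * snd z) \<le> 2 * 2"
      using that by (intro mult_mono half ab) auto
    then show ?thesis using Pz[OF that] by simp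
  qed
  have Plt: "cmod (bd_apply P z) < 1" if z: "z \<in> closed_bidisc" "z \<noteq> t" for z
  proof -
    have le: "cmod (1 + cnj a * fst z) \<le> 2" "cmod (1 + cnj b * snd z) \<le> 2"
      using z by (auto intro!: half ab)
    have "cmod (1 + cnj a * fst z) < 2 \<or> cmod (1 + cnj b * snd z) < 2"
      using half(2)[OF ab(2), of "fst z"] half(2)[OF ab(3), of "snd z"] z le by (force simp: ab)
    moreover have "x * y < 4" if "x < 2" "y \<le> 2" "0 \<le> x" for x y :: real
      using mult_left_mono[OF that(2,3)] that(1) by linarith
    ultimately have "cmod (1 + cnj a * fst z) * cmod (1 + cnj b * snd z) < 4"
      using le by (metis mult.commute norm_ge_zero)
    then show ?thesis using Pz[OF z(1)] by simp
  qed
  have Pt: "bd_apply P t = 1"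
    using ab t complex_norm_square[of a] complex_norm_square[of b] by (simp add: P_def mult.commute[of "cnj _"])
  have tc: "t \<in> closed_bidisc" using t by auto
  obtain d where d: "d > 0" "\<And>z. z \<in> closed_bidisc \<Longrightarrow> dist z t < d \<Longrightarrow> cmod (bd_apply g z) < e / 2"
  proof -
    obtain d where "d > 0" "\<forall>z\<in>closed_bidisc. dist z t < d \<longrightarrow> dist (bd_apply g z) (bd_apply g t) < e / 2"
      using bd_apply_props(1)[of g] tc half_gt_zero[OF e] unfolding continuous_on_iff by blast
    then show ?thesis using g by (intro that[of d]) auto
  qed
  have "\<exists>r. 0 \<le> r \<and> r < 1 \<and> (\<forall>z\<in>closed_bidisc - ball t d. cmod (bd_apply P z) \<le> r)"
  proof (cases "closed_bidisc - ball t d = {}")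
    case False
    have comp: "compact (closed_bidisc - ball t d)"
      by (intro compact_diff compact_Times) auto
    have "continuous_on (closed_bidisc - ball t d) (\<lambda>z. cmod (bd_apply P z))"
      by (intro continuous_on_norm continuous_on_subset[OF bd_apply_props(1)]) auto
    then obtain z where z: "z \<in> closed_bidisc - ball t d"
      "\<And>y. y \<in> closed_bidisc - ball t d \<Longrightarrow> cmod (bd_apply P y) \<le> cmod (bd_apply P z)"
      using continuous_attains_sup[OF comp False] by blast
    have "z \<noteq> t" using z(1) d by auto
    then show ?thesis using z Plt[of z] by (intro exI[of _ "cmod (bd_apply P z)"]) auto
  qed (auto intro!: exI[of _ 0])
  then obtain r where r: "0 \<le> r" "r < 1" "\<And>z. z \<in> closed_bidisc - ball t d \<Longrightarrow> cmod (bd_apply P z) \<le> r"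
    by auto
  \<comment> \<open>Away from \<open>t\<close> the powers of \<open>P\<close> beat the bound for
    \<open>g\<close>; near \<open>t\<close> the function \<open>g\<close> itself is small.\<close>
  have "(\<lambda>n. norm g * r ^ n) \<longlonglongrightarrow> norm g * 0"
    by (intro tendsto_mult_left LIMSEQ_realpow_zero r)
  then have "\<forall>\<^sub>F n in sequentially. norm g * r ^ n < e / 2"
    using e by (intro order_tendstoD(2)[of _ 0]) auto
  then obtain n where n: "norm g * r ^ n < e / 2" by (auto simp: eventually_sequentially)
  have "norm (P ^ n) = 1"
  proof (rule antisym)
    show "norm (P ^ n) \<le> 1"
      by (rule bd_norm_least) (simp add: norm_power power_le_one Ple)
    show "1 \<le> norm (P ^ n)"
      using bd_norm_upper[OF tc, of "P ^ n"] tc by (simp add: Pt)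
  qed
  moreover have "norm (g * P ^ n) \<le> e / 2"
  proof (rule bd_norm_least)
    fix z :: "complex \<times> complex" assume z: "z \<in> closed_bidisc"
    show "cmod (bd_apply (g * P ^ n) z) \<le> e / 2"
    proof (cases "dist z t < d")
      case True
      have "cmod (bd_apply g z) * cmod (bd_apply P z) ^ n \<le> e / 2 * 1"
        using d(2)[OF z True] Ple[OF z] e by (intro mult_mono) (auto simp: power_le_one)
      then show ?thesis using z by (simp add: norm_mult norm_power)
    next
      case False
      then have "cmod (bd_apply P z) \<le> r" using z by (intro r) (auto simp: dist_commute)
      then have "cmod (bd_apply g z) * cmod (bd_apply P z) ^ n \<le> norm g * r ^ n"
        using bd_norm_upper[OF z, of g] by (intro mult_mono power_mono) auto
      then show ?thesis using z n by (simp add: norm_mult norm_power)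
    qed
  qed
  ultimately show ?thesis using e by (intro exI[of _ "P ^ n"]) auto
qed

lemma times_bounded_below:
  assumes "\<And>t. t \<in> torus \<Longrightarrow> bd_apply g t \<noteq> 0"
  shows "\<exists>c>0. \<forall>f. c * norm f \<le> norm (g * f)"
proof -
  have "continuous_on torus (\<lambda>z. cmod (bd_apply g z))"
    by (intro continuous_on_norm continuous_on_subset[OF bd_apply_props(1)]) auto
  moreover have "compact (torus :: (complex \<times> complex) set)" "(1, 1) \<in> torus"
    by (auto intro!: compact_Times)
  ultimately obtain t where t: "t \<in> torus" "\<And>z. z \<in> torus \<Longrightarrow> cmod (bd_apply g t) \<le> cmod (bd_apply g z)"
    using continuous_attains_inf by (metis (no_types, lifting) empty_iff)
  define c where "c = cmod (bd_apply g t)"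
  have c: "c > 0" using assms t by (simp add: c_def)
  have "norm f \<le> norm (g * f) / c" for f
  proof (rule bd_norm_torus_least)
    fix z :: "complex \<times> complex" assume z: "z \<in> torus"
    have "c * cmod (bd_apply f z) \<le> cmod (bd_apply g z) * cmod (bd_apply f z)"
      using t(2)[OF z] by (intro mult_right_mono) (auto simp: c_def)
    also have "\<dots> \<le> norm (g * f)"
      using bd_norm_upper[of z "g * f"] z by (auto simp: norm_mult)
    finally show "cmod (bd_apply f z) \<le> norm (g * f) / c" using c by (simp add: field_simps)
  qed
  then show ?thesis using c by (intro exI[of _ c]) (auto simp: field_simps)
qed

section \<open>The bounded inverse theorem\<close>

text \<open>The open mapping argument. By Baire's theorem the closure of the image of some ball of
  \<open>D\<close> has interior in the complete space \<open>S ` D\<close>; by symmetry and scaling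
  every \<open>y\<close> in the image is then approximated within \<open>norm y / 2\<close> by
  \<open>S x\<close> with \<open>norm x \<le> C * norm y\<close>. Summing the successive corrections
  solves \<open>S s = y\<close> with a bounded \<open>s\<close>, and injectivity identifies
  \<open>s\<close> with the given preimage. The restriction to a subspace \<open>D\<close> allows
  adjoining a finite-dimensional summand to the domain below.\<close>

lemma bounded_inverse_on_subspace:
  fixes S :: "'a::banach \<Rightarrow> 'b::banach"
  assumes S: "bounded_linear S" and D: "subspace D" "closed D"
    and inj: "\<And>x. x \<in> D \<Longrightarrow> S x = 0 \<Longrightarrow> x = 0" and cl: "closed (S ` D)"
  shows "\<exists>c>0. \<forall>x\<in>D. c * norm x \<le> norm (S x)"
proof -
  interpret S: bounded_linear S by fact
  define Y where "Y = S ` D"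
  define K where "K n = S ` (D \<inter> cball 0 (real n))" for n :: nat
  have subY: "subspace Y" unfolding Y_def
    using D(1) S.linear_axioms by (rule linear_subspace_image[rotated])
  have KY: "closure (K n) \<subseteq> Y" for n
    by (rule closure_minimal) (use cl in \<open>auto simp: K_def Y_def\<close>)
  have cover: "Y = (\<Union>n. closure (K n))"
  proof
    show "Y \<subseteq> (\<Union>n. closure (K n))"
    proof
      fix y assume "y \<in> Y"
      then obtain x where x: "x \<in> D" "y = S x" by (auto simp: Y_def)
      obtain n where "norm x \<le> real n" using real_arch_simple by blast
      then have "y \<in> K n" using x by (auto simp: K_def)
      then show "y \<in> (\<Union>n. closure (K n))" using closure_subset by blast
    qed
  qed (use KY in auto)
  have metr: "completely_metrizable_space (top_of_set Y)"
    using cl by (intro completely_metrizable_space_closedin completely_metrizable_space_euclidean) (simp add: Y_def)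
  have "\<exists>n. top_of_set Y interior_of closure (K n) \<noteq> {}"
  proof (rule ccontr)
    assume no: "\<not> ?thesis"
    have "top_of_set Y interior_of \<Union>(range (\<lambda>n. closure (K n))) = {}"
      by (rule Baire_category_alt) (use metr KY no in \<open>auto intro!: closed_subset\<close>)
    then have "top_of_set Y interior_of Y = {}" using cover by simp
    then have "Y = {}" by (metis interior_of_topspace topspace_euclidean_subtopology)
    then show False using D(1) by (auto simp: Y_def dest: subspace_0)
  qed
  then obtain n y0 where y0: "y0 \<in> top_of_set Y interior_of closure (K n)" by auto
  then obtain U where U: "openin (top_of_set Y) U" "y0 \<in> U" "U \<subseteq> closure (K n)"
    unfolding interior_of_def by auto
  then obtain r where r: "r > 0" "ball y0 r \<inter> Y \<subseteq> U"
    unfolding openin_contains_ball by blast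
  have y0Y: "y0 \<in> Y" using U(1,2) openin_imp_subset by blast
  have approx: "\<exists>x\<in>D. norm x \<le> real n \<and> norm (y - S x) < e"
    if y: "y \<in> Y" "norm y < r" and e: "e > 0" for y e
  proof -
    have "y0 + y \<in> closure (K n)" "y0 - y \<in> closure (K n)"
      using y y0Y r(2) U(3) subspace_add[OF subY] subspace_diff[OF subY] by (auto simp: dist_norm subset_iff)
    then obtain k1 k2 where k: "k1 \<in> K n" "dist k1 (y0 + y) < e" "k2 \<in> K n" "dist k2 (y0 - y) < e"
      using e unfolding closure_approachable by meson
    then obtain x1 x2 where x: "x1 \<in> D" "x2 \<in> D" "norm x1 \<le> real n" "norm x2 \<le> real n" "k1 = S x1" "k2 = S x2"
      by (auto simp: K_def)
    define x where "x = (1/2) *\<^sub>R (x1 - x2)"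
    have "x \<in> D" using x D(1) by (auto simp: x_def intro!: subspace_scale subspace_diff)
    moreover have "norm x \<le> real n"
      using x norm_triangle_ineq4[of x1 x2] by (simp add: x_def)
    moreover have "norm (y - S x) < e"
    proof -
      have "y - S x = (1/2) *\<^sub>R ((y0 + y - k1) - (y0 - y - k2))"
        by (simp add: x_def x S.scaleR S.diff algebra_simps flip: scaleR_add_left)
      then have "norm (y - S x) = (1/2) * norm ((y0 + y - k1) - (y0 - y - k2))" by simp
      also have "\<dots> \<le> (1/2) * (norm (y0 + y - k1) + norm (y0 - y - k2))"
        by (intro mult_left_mono norm_triangle_ineq4) auto
      also have "\<dots> < e" using k by (simp add: dist_norm norm_minus_commute)
      finally show ?thesis .
    qed
    ultimately show ?thesis by blast
  qed
  \<comment> \<open>Scaling \<open>y\<close> to norm \<open>r / 2\<close>, where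
    \<open>approx\<close> applies, costs the factor \<open>2 * n / r\<close>.\<close>
  define C where "C = 2 * real n / r"
  have C0: "C \<ge> 0" using r by (simp add: C_def)
  have approx': "\<exists>x\<in>D. norm x \<le> C * norm y \<and> norm (y - S x) \<le> norm y / 2" if y: "y \<in> Y" for y
  proof (cases "y = 0")
    case True
    then show ?thesis using subspace_0[OF D(1)] by (intro bexI[of _ 0]) auto
  next
    case False
    define t where "t = r / (2 * norm y)"
    have t: "t > 0" "t * norm y = r / 2" using False r by (auto simp: t_def)
    obtain x where x: "x \<in> D" "norm x \<le> real n" "norm (t *\<^sub>R y - S x) < t * norm y / 2"
      using approx[of "t *\<^sub>R y" "t * norm y / 2"] t r False y subspace_scale[OF subY] by auto
    have "norm (inverse t *\<^sub>R x) \<le> C * norm y"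
      using x(2) t False r by (simp add: C_def t_def field_simps)
    moreover have "y - S (inverse t *\<^sub>R x) = inverse t *\<^sub>R (t *\<^sub>R y - S x)"
      using t by (simp add: S.scaleR algebra_simps)
    then have "norm (y - S (inverse t *\<^sub>R x)) \<le> norm y / 2"
      using mult_strict_left_mono[OF x(3), of "inverse t"] t(1) by (simp add: mult.assoc[symmetric])
    ultimately show ?thesis using x(1) subspace_scale[OF D(1)] by blast
  qed
  then obtain X where X: "\<And>y. y \<in> Y \<Longrightarrow> X y \<in> D" "\<And>y. y \<in> Y \<Longrightarrow> norm (X y) \<le> C * norm y"
    "\<And>y. y \<in> Y \<Longrightarrow> norm (y - S (X y)) \<le> norm y / 2"
    by metis
  have bound: "norm x \<le> 2 * C * norm (S x)" if x: "x \<in> D" for x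
  proof -
    define y where "y k = ((\<lambda>y. y - S (X y)) ^^ k) (S x)" for k
    have ySuc: "y (Suc k) = y k - S (X (y k))" for k by (simp add: y_def)
    have yY: "y k \<in> Y" for k
    proof (induction k)
      case 0
      then show ?case using x by (simp add: y_def Y_def)
    next
      case (Suc k)
      then show ?case unfolding ySuc
        using X(1) by (intro subspace_diff[OF subY]) (auto simp: Y_def)
    qed
    have yn: "norm (y k) \<le> norm (S x) * (1/2) ^ k" for k
    proof (induction k)
      case (Suc k)
      then show ?case using X(3)[OF yY[of k]] by (simp add: ySuc)
    qed (simp add: y_def)
    have Xn: "norm (X (y k)) \<le> C * norm (S x) * (1/2) ^ k" for k
      using X(2)[OF yY[of k]] mult_left_mono[OF yn[of k] C0] by simp
    have geo: "(\<lambda>k. C * norm (S x) * (1/2) ^ k) sums (C * norm (S x) * 2)"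
      using geometric_sums[of "1/2 :: real"] by (intro sums_mult) simp
    have sn: "summable (\<lambda>k. norm (X (y k)))"
      by (rule summable_comparison_test'[OF sums_summable[OF geo], of 0]) (use Xn in simp)
    then have sm: "summable (\<lambda>k. X (y k))" by (rule summable_norm_cancel)
    define s where "s = (\<Sum>k. X (y k))"
    have "(\<lambda>k. \<Sum>i<k. X (y i)) \<longlonglongrightarrow> s" unfolding s_def by (rule summable_LIMSEQ[OF sm])
    then have sD: "s \<in> D"
      by (rule closed_sequentially[OF D(2), rotated]) (auto intro!: subspace_sum[OF D(1)] X yY)
    have part: "(\<Sum>i<k. S (X (y i))) = S x - y k" for k
      by (induction k) (auto simp: ySuc y_def)
    have "y \<longlonglongrightarrow> 0"
    proof (rule Lim_null_comparison[OF always_eventually])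
      show "\<forall>k. norm (y k) \<le> norm (S x) * (1/2) ^ k" using yn by blast
      show "(\<lambda>k. norm (S x) * (1/2) ^ k) \<longlonglongrightarrow> 0"
        by (intro tendsto_mult_right_zero LIMSEQ_realpow_zero) auto
    qed
    then have "(\<lambda>k. S x - y k) \<longlonglongrightarrow> S x - 0" by (intro tendsto_intros)
    then have "(\<lambda>i. S (X (y i))) sums S x" by (simp add: sums_def part)
    then have "S s = S x" using S.sums[OF summable_sums[OF sm]] unfolding s_def by (rule sums_unique2[rotated])
    then have "s = x" using inj[of "s - x"] sD x subspace_diff[OF D(1)] by (simp add: S.diff)
    moreover have "norm s \<le> (\<Sum>k. norm (X (y k)))" unfolding s_def by (rule summable_norm[OF sn])
    moreover have "(\<Sum>k. norm (X (y k))) \<le> C * norm (S x) * 2"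
      using suminf_le[OF Xn sn sums_summable[OF geo]] sums_unique[OF geo] by simp
    ultimately show ?thesis by simp
  qed
  show ?thesis
  \<comment> \<open>The summand \<open>1\<close> keeps the constant finite if \<open>C =
    0\<close>.\<close>
  proof (intro exI[of _ "1 / (2 * C + 1)"] conjI ballI)
    fix x assume "x \<in> D"
    then have "norm x \<le> (2 * C + 1) * norm (S x)"
      using bound[OF \<open>x \<in> D\<close>] norm_ge_zero[of "S x"] unfolding distrib_right mult_1_left by linarith
    then show "1 / (2 * C + 1) * norm x \<le> norm (S x)"
      using C0 by (simp add: field_simps)
  qed (use C0 in simp)
qed

section \<open>Bounded complex linear operators and finite codimension\<close>

lemma bounded_clinearD:
  assumes "bounded_clinear S"
  shows "bounded_linear S" "S (x + y) = S x + S y" "S (x - y) = S x - S y" "S 0 = 0"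
    "S (c *\<^sub>C x) = c *\<^sub>C S x" "S (sum f A) = (\<Sum>a\<in>A. S (f a))" "S (- x) = - S x"
  using assms unfolding bounded_clinear_def
  by (auto simp: linear_simps linear_sum bounded_linear.linear)

lemma bounded_clinearI:
  assumes "\<And>x y. S (x + y) = S x + S y" "\<And>c x. S (c *\<^sub>C x) = c *\<^sub>C S x"
    "\<And>x. norm (S x) \<le> norm x * K"
  shows "bounded_clinear S"
  unfolding bounded_clinear_def
  using assms bounded_linear_intro[of S K] by (metis scaleC_of_real)

lemma bounded_clinear_compose:
  "bounded_clinear S \<Longrightarrow> bounded_clinear T \<Longrightarrow> bounded_clinear (S \<circ> T)"
  unfolding bounded_clinear_def by (auto simp: o_def bounded_linear_compose)

lemma bounded_clinear_scaleC: "bounded_clinear (\<lambda>x. c *\<^sub>C x)"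
  by (rule bounded_clinearI[of _ "cmod c"])
    (auto simp: scaleC_add_right scaleC_scaleC norm_scaleC mult.commute)

lemma bounded_clinear_add:
  "bounded_clinear S \<Longrightarrow> bounded_clinear T \<Longrightarrow> bounded_clinear (\<lambda>x. S x + T x)"
  unfolding bounded_clinear_def by (auto simp: bounded_linear_add scaleC_add_right)

lemma bounded_clinear_diff:
  "bounded_clinear S \<Longrightarrow> bounded_clinear T \<Longrightarrow> bounded_clinear (\<lambda>x. S x - T x)"
  unfolding bounded_clinear_def
  by (auto simp: bounded_linear_sub complex_vector.scale_right_diff_distrib)

lemma bounded_clinear_shifted: "bounded_clinear T \<Longrightarrow> bounded_clinear (shifted \<mu> T)"
  unfolding shifted_def by (intro bounded_clinear_diff bounded_clinear_scaleC)

lemma subspace_range: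
  assumes "bounded_clinear S" shows "complex_vector.subspace (range S)"
proof -
  note S = bounded_clinearD[OF assms]
  show ?thesis
    unfolding complex_vector.subspace_def
    by (auto simp flip: S(2,4,5))
qed

lemma image_span:
  assumes "bounded_clinear S" "v \<in> complex_vector.span B"
  shows "S v \<in> complex_vector.span (S ` B)"
  using assms(2)
proof (induction rule: complex_vector.span_induct_alt)
  case base
  then show ?case by (simp add: bounded_clinearD[OF assms(1)] complex_vector.span_zero)
next
  case (step c x y)
  have "c *\<^sub>C S x + S y \<in> complex_vector.span (S ` B)"
    by (intro complex_vector.span_add[OF complex_vector.span_scale[OF complex_vector.span_base] step(2)] imageI step(1))
  then show ?case by (simp add: bounded_clinearD[OF assms(1)])
qed

lemma fin_codim_iff:
  assumes "complex_vector.subspace Y"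
  shows "fin_codim Y \<longleftrightarrow> (\<exists>B. finite B \<and> (\<forall>x. \<exists>y\<in>Y. \<exists>b\<in>complex_vector.span B. x = y + b))"
proof -
  have "complex_vector.span (Y \<union> B) = UNIV \<longleftrightarrow> (\<forall>x. \<exists>y\<in>Y. \<exists>b\<in>complex_vector.span B. x = y + b)" for B
    unfolding complex_vector.span_Un complex_vector.span_eq_iff[THEN iffD2, OF assms] by blast
  then show ?thesis by (simp add: fin_codim_def)
qed

lemma fin_codim_range_iff:
  assumes "bounded_clinear S"
  shows "fin_codim (range S) \<longleftrightarrow> (\<exists>B. finite B \<and> (\<forall>x. \<exists>y. \<exists>b\<in>complex_vector.span B. x = S y + b))"
  by (simp add: fin_codim_iff[OF subspace_range[OF assms]])

lemma fin_codim_compose: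
  assumes S: "bounded_clinear S" "fin_codim (range S)" and T: "bounded_clinear T" "fin_codim (range T)"
  shows "fin_codim (range (S \<circ> T))"
proof -
  obtain A where A: "finite A" "\<And>x. \<exists>y. \<exists>a\<in>complex_vector.span A. x = S y + a"
    using S(2) unfolding fin_codim_range_iff[OF S(1)] by auto
  obtain B where B: "finite B" "\<And>x. \<exists>y. \<exists>b\<in>complex_vector.span B. x = T y + b"
    using T(2) unfolding fin_codim_range_iff[OF T(1)] by auto
  show ?thesis
    unfolding fin_codim_range_iff[OF bounded_clinear_compose[OF S(1) T(1)]]
  proof (intro exI[of _ "S ` B \<union> A"] conjI allI)
    fix x
    obtain y a where y: "a \<in> complex_vector.span A" "x = S y + a" using A(2) by meson
    obtain z b where z: "b \<in> complex_vector.span B" "y = T z + b" using B(2) by meson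
    have "S b \<in> complex_vector.span (S ` B \<union> A)"
      using image_span[OF S(1) z(1)] complex_vector.span_mono[of "S ` B" "S ` B \<union> A"] by auto
    moreover have "a \<in> complex_vector.span (S ` B \<union> A)"
      using y(1) complex_vector.span_mono[of A "S ` B \<union> A"] by auto
    ultimately have "S b + a \<in> complex_vector.span (S ` B \<union> A)" by (rule complex_vector.span_add)
    moreover have "x = (S \<circ> T) z + (S b + a)"
      using y z by (simp add: bounded_clinearD[OF S(1)] add.assoc)
    ultimately show "\<exists>y. \<exists>b\<in>complex_vector.span (S ` B \<union> A). x = (S \<circ> T) y + b" by blast
  qed (use A B in auto)
qed

text \<open>The preimage of a subspace of finite codimension under a linear map has finite
  codimension: only finitely many directions \<open>C\<close> in a complement of \<open>Y\<close>
  are hit modulo \<open>Y\<close>, and choosing one preimage for each suffices.\<close>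

lemma fin_codim_preimage:
  assumes J: "bounded_clinear J" and Y: "complex_vector.subspace Y" "fin_codim Y"
    and Y': "complex_vector.subspace Y'" and sub: "\<And>h. J h \<in> Y \<Longrightarrow> h \<in> Y'"
  shows "fin_codim Y'"
proof -
  obtain B where B: "finite B" "\<And>x. \<exists>y\<in>Y. \<exists>b\<in>complex_vector.span B. x = y + b"
    using Y fin_codim_iff by blast
  define V where "V = {v \<in> complex_vector.span B. \<exists>h. J h - v \<in> Y}"
  obtain C where C: "C \<subseteq> V" "complex_vector.independent C" "V \<subseteq> complex_vector.span C"
    using complex_vector.maximal_independent_subset by blast
  have finC: "finite C"
    using complex_vector.independent_span_bound[OF B(1) C(2)] C(1) by (auto simp: V_def)
  have "\<forall>c\<in>C. \<exists>h. J h - c \<in> Y" using C(1) by (auto simp: V_def)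
  then obtain h where h: "\<And>c. c \<in> C \<Longrightarrow> J (h c) - c \<in> Y" by metis
  show ?thesis
    unfolding fin_codim_iff[OF Y']
  proof (intro exI[of _ "h ` C"] conjI allI)
    fix x
    obtain y v where yv: "y \<in> Y" "v \<in> complex_vector.span B" "J x = y + v" using B(2) by blast
    then have "v \<in> V" by (auto simp: V_def intro!: exI[of _ x])
    then have "v \<in> complex_vector.span C" using C(3) by blast
    then obtain u where u: "v = (\<Sum>c\<in>C. u c *\<^sub>C c)"
      unfolding complex_vector.span_finite[OF finC] by auto
    define b where "b = (\<Sum>c\<in>C. u c *\<^sub>C h c)"
    have "J (x - b) = y - (\<Sum>c\<in>C. u c *\<^sub>C (J (h c) - c))"
      by (simp add: bounded_clinearD[OF J] b_def yv u complex_vector.scale_right_diff_distrib sum_subtractf)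
    also have "\<dots> \<in> Y"
      by (intro complex_vector.subspace_diff[OF Y(1) yv(1)] complex_vector.subspace_sum[OF Y(1)]
          complex_vector.subspace_scale[OF Y(1)] h)
    finally have "x - b \<in> Y'" by (rule sub)
    moreover have "b \<in> complex_vector.span (h ` C)"
      unfolding b_def by (intro complex_vector.span_sum complex_vector.span_scale complex_vector.span_base) auto
    ultimately show "\<exists>y\<in>Y'. \<exists>b\<in>complex_vector.span (h ` C). x = y + b"
      by (intro bexI[of _ "x - b"] bexI[of _ b]) auto
  qed (use finC in auto)
qed

text \<open>A sequence of vectors becomes linearly dependent modulo a subspace of finite
  codimension. Stated for sequences so that, applied to powers of an element, it produces a nonzero
  polynomial.\<close>

lemma nontrivial_combination:
  fixes v :: "nat \<Rightarrow> 'a::complex_normed_vector"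
  assumes Y: "complex_vector.subspace Y" and B: "finite B"
    and v: "\<And>i. \<exists>y\<in>Y. \<exists>b\<in>complex_vector.span B. v i = y + b"
  shows "\<exists>n c. (\<exists>i\<le>n. c i \<noteq> 0) \<and> (\<Sum>i\<le>n. c i *\<^sub>C v i) \<in> Y"
proof -
  obtain y b where yb: "\<And>i. y i \<in> Y" "\<And>i. b i \<in> complex_vector.span B" "\<And>i. v i = y i + b i"
    using v by metis
  define n where "n = card B"
  have "\<exists>c. (\<exists>i\<le>n. c i \<noteq> 0) \<and> (\<Sum>i\<le>n. c i *\<^sub>C b i) = 0"
  proof (cases "inj_on b {..n}")
    case True
    have "complex_vector.dependent (b ` {..n})"
    proof (rule ccontr)
      assume "\<not> ?thesis"
      then have "card (b ` {..n}) \<le> card B"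
        using complex_vector.independent_span_bound[OF B, of "b ` {..n}"] yb(2) by blast
      then show False using card_image[OF True] by (simp add: n_def)
    qed
    then obtain u where u: "\<exists>w\<in>b ` {..n}. u w \<noteq> 0" "(\<Sum>w\<in>b ` {..n}. u w *\<^sub>C w) = 0"
      using complex_vector.dependent_finite[of "b ` {..n}"] by auto
    then show ?thesis
      by (intro exI[of _ "u \<circ> b"]) (auto simp: sum.reindex[OF True])
  next
    case False
    then obtain i j where ij: "i \<le> n" "j \<le> n" "i \<noteq> j" "b i = b j" by (auto simp: inj_on_def)
    \<comment> \<open>Two equal vectors: their difference is the relation.\<close>
    define c :: "nat \<Rightarrow> complex" where "c = (\<lambda>k. (if k = i then 1 else 0) + (if k = j then - 1 else 0))"
    have "c k *\<^sub>C b k = (if k = i then b i else 0) + (if k = j then - b j else 0)" for k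
      using ij by (auto simp: c_def scaleC_add_left)
    then have "(\<Sum>k\<le>n. c k *\<^sub>C b k) = 0"
      using ij by (simp add: sum.distrib)
    moreover have "c i \<noteq> 0" using ij by (simp add: c_def)
    ultimately show ?thesis using ij by blast
  qed
  then obtain c where c: "\<exists>i\<le>n. c i \<noteq> 0" "(\<Sum>i\<le>n. c i *\<^sub>C b i) = 0" by blast
  have "(\<Sum>i\<le>n. c i *\<^sub>C v i) = (\<Sum>i\<le>n. c i *\<^sub>C y i)"
    by (simp add: yb(3) scaleC_add_right sum.distrib c)
  also have "\<dots> \<in> Y"
    by (intro complex_vector.subspace_sum[OF Y] complex_vector.subspace_scale[OF Y] yb)
  finally show ?thesis using c by blast
qed

lemma tendsto_scaleC:
  fixes b :: "'a::complex_normed_vector"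
  assumes "(c \<longlongrightarrow> c0) F"
  shows "((\<lambda>n. c n *\<^sub>C b) \<longlongrightarrow> c0 *\<^sub>C b) F"
proof -
  have "((\<lambda>n. cmod (c n - c0) * norm b) \<longlongrightarrow> 0) F"
    using assms by (intro tendsto_mult_left_zero tendsto_norm_zero LIM_zero)
  then have "((\<lambda>n. norm (c n *\<^sub>C b - c0 *\<^sub>C b)) \<longlongrightarrow> 0) F"
    by (simp add: norm_scaleC flip: complex_vector.scale_left_diff_distrib)
  then show ?thesis by (rule LIM_zero_cancel[OF tendsto_norm_zero_cancel])
qed

text \<open>Adding one vector \<open>b\<close> at positive distance \<open>d\<close> from a closed
  span: the coefficients of \<open>b\<close> in a convergent sequence are Cauchy because they are
  controlled by \<open>1 / d\<close> times the norm.\<close>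

lemma closed_span_finite:
  fixes B :: "'a::complex_normed_vector set"
  assumes "finite B"
  shows "closed (complex_vector.span B)"
  using assms
proof (induction B rule: finite_induct)
  case (insert b B)
  show ?case
  proof (cases "b \<in> complex_vector.span B")
    case True
    then show ?thesis using insert by (simp add: complex_vector.span_redundant)
  next
    case False
    then obtain d where d: "d > 0" "ball b d \<subseteq> - complex_vector.span B"
      using insert.IH open_contains_ball[of "- complex_vector.span B"] by (auto simp: open_closed)
    have coef: "cmod c * d \<le> norm (c *\<^sub>C b + s)" if s: "s \<in> complex_vector.span B" for c s
    proof (cases "c = 0")
      case False
      have "- (inverse c *\<^sub>C s) \<in> complex_vector.span B"
        using s by (intro complex_vector.span_neg complex_vector.span_scale)
      then have "d \<le> norm (b + inverse c *\<^sub>C s)"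
        using d(2) by (force simp: dist_norm)
      moreover have "c *\<^sub>C b + s = c *\<^sub>C (b + inverse c *\<^sub>C s)"
        using False by (simp add: scaleC_add_right scaleC_scaleC)
      ultimately show ?thesis by (simp add: norm_scaleC mult_left_mono)
    qed (use d in simp)
    show ?thesis
      unfolding closed_sequential_limits
    proof (intro allI impI, elim conjE)
      fix y l assume y: "\<forall>n. y n \<in> complex_vector.span (insert b B)" and l: "y \<longlonglongrightarrow> l"
      have "\<forall>n. \<exists>k. y n - k *\<^sub>C b \<in> complex_vector.span B"
        using y by (simp add: complex_vector.span_insert)
      then obtain c where c: "\<And>n. y n - c n *\<^sub>C b \<in> complex_vector.span B"
        by metis
      have "Cauchy c"
      proof (rule metric_CauchyI)
        fix e :: real assume "e > 0"
        then obtain N where N: "\<And>m n. m \<ge> N \<Longrightarrow> n \<ge> N \<Longrightarrow> norm (y m - y n) < e * d"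
          using CauchyD[OF LIMSEQ_imp_Cauchy[OF l], of "e * d"] d by auto
        have "dist (c m) (c n) < e" if "m \<ge> N" "n \<ge> N" for m n
        proof -
          have "cmod (c m - c n) * d \<le> norm ((c m - c n) *\<^sub>C b + ((y m - c m *\<^sub>C b) - (y n - c n *\<^sub>C b)))"
            by (rule coef) (intro complex_vector.span_diff c)
          also have "\<dots> = norm (y m - y n)" by (simp add: complex_vector.scale_left_diff_distrib)
          also have "\<dots> < e * d" using N that by blast
          finally show ?thesis using d by (simp add: dist_norm)
        qed
        then show "\<exists>M. \<forall>m\<ge>M. \<forall>n\<ge>M. dist (c m) (c n) < e" by blast
      qed
      then obtain c0 where "c \<longlonglongrightarrow> c0" using Cauchy_convergent_iff convergent_def by blast
      then have "(\<lambda>n. c n *\<^sub>C b) \<longlonglongrightarrow> c0 *\<^sub>C b"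
        by (rule tendsto_scaleC)
      then have "(\<lambda>n. y n - c n *\<^sub>C b) \<longlonglongrightarrow> l - c0 *\<^sub>C b" using l by (intro tendsto_diff)
      then have "l - c0 *\<^sub>C b \<in> complex_vector.span B"
        by (rule closed_sequentially[OF insert.IH c])
      then show "l \<in> complex_vector.span (insert b B)"
        unfolding complex_vector.span_insert by blast
    qed
  qed
qed simp

section \<open>Operators bounded below and their role in the spectra\<close>

definition bounded_below :: "('a::real_normed_vector \<Rightarrow> 'b::real_normed_vector) \<Rightarrow> bool" where
  "bounded_below S \<longleftrightarrow> (\<exists>c>0. \<forall>x. c * norm x \<le> norm (S x))"

text \<open>Choose a spanning complement \<open>B\<close> of the range with as few elements as
  possible. Minimality makes \<open>(x, y) \<mapsto> S x + y\<close> a bijection from the closed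
  subspace \<open>UNIV \<times> span B\<close> onto the whole space, to which the bounded inverse
  theorem applies.\<close>

lemma bounded_below_fin_codim:
  fixes S :: "'a::complex_banach \<Rightarrow> 'b::complex_banach"
  assumes S: "bounded_clinear S" and inj: "\<And>x. S x = 0 \<Longrightarrow> x = 0" and cod: "fin_codim (range S)"
  shows "bounded_below S"
proof -
  define P where "P n \<longleftrightarrow> (\<exists>B. finite B \<and> card B = n \<and> complex_vector.span (range S \<union> B) = UNIV)" for n
  have "\<exists>n. P n" using cod by (auto simp: fin_codim_def P_def)
  then have "P (LEAST n. P n)" by (rule LeastI_ex)
  then obtain B where B: "finite B" "card B = (LEAST n. P n)" "complex_vector.span (range S \<union> B) = UNIV"
    unfolding P_def[of "LEAST n. P n"] by blast
  have triv: "y = 0" if y: "y \<in> complex_vector.span B" "y \<in> range S" for y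
  proof (rule ccontr)
    assume "y \<noteq> 0"
    obtain u where u: "y = (\<Sum>b\<in>B. u b *\<^sub>C b)"
      using y(1) unfolding complex_vector.span_finite[OF B(1)] by auto
    then obtain b where b: "b \<in> B" "u b \<noteq> 0"
      using \<open>y \<noteq> 0\<close> by (metis (no_types, lifting) complex_vector.scale_zero_left sum.neutral)
    let ?W = "complex_vector.span (range S \<union> (B - {b}))"
    have "u b *\<^sub>C b = y - (\<Sum>b\<in>B - {b}. u b *\<^sub>C b)"
      using b B(1) by (simp add: u sum.remove[of B b])
    moreover have "y - (\<Sum>b\<in>B - {b}. u b *\<^sub>C b) \<in> ?W"
      using y(2) by (intro complex_vector.span_diff complex_vector.span_sum complex_vector.span_scale)
        (auto intro: complex_vector.span_base)
    ultimately have "u b *\<^sub>C b \<in> ?W" by simp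
    then have "inverse (u b) *\<^sub>C (u b *\<^sub>C b) \<in> ?W"
      by (rule complex_vector.span_scale)
    then have "b \<in> ?W" using b by (simp add: scaleC_scaleC complex_vector.scale_one)
    then have "complex_vector.span (range S \<union> B) \<subseteq> ?W"
      by (intro complex_vector.span_minimal) (auto intro: complex_vector.span_base)
    then have "P (card (B - {b}))" using B by (auto simp: P_def)
    then have "card B \<le> card (B - {b})" unfolding B(2) by (rule Least_le)
    then show False using b B(1) by (metis card_Diff1_less leD)
  qed
  let ?D = "UNIV \<times> complex_vector.span B"
  let ?S = "\<lambda>z. S (fst z) + snd z"
  have "\<exists>c>0. \<forall>z\<in>?D. c * norm z \<le> norm (?S z)"
  proof (rule bounded_inverse_on_subspace)
    show "bounded_linear ?S"
      by (intro bounded_linear_add bounded_linear_snd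
          bounded_linear_compose[OF bounded_clinearD(1)[OF S] bounded_linear_fst])
    show "subspace ?D"
      unfolding subspace_def
      by (auto simp: zero_prod_def complex_vector.span_zero complex_vector.span_add
          complex_vector.span_scale simp flip: scaleC_of_real)
    show "closed ?D" by (intro closed_Times closed_UNIV closed_span_finite B(1))
    show "closed (?S ` ?D)"
    proof -
      have "x \<in> ?S ` ?D" for x
      proof -
        have "x \<in> complex_vector.span (range S \<union> B)" using B(3) by simp
        then obtain a b where "a \<in> range S" "b \<in> complex_vector.span B" "x = a + b"
          unfolding complex_vector.span_Un complex_vector.span_eq_iff[THEN iffD2, OF subspace_range[OF S]]
          by blast
        then show ?thesis by force
      qed
      then have "?S ` ?D = UNIV" by blast
      then show ?thesis by simp
    qed
    fix z assume z: "z \<in> ?D" "?S z = 0"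
    then have "snd z = S (- fst z)"
      using bounded_clinearD(1)[OF S] by (simp add: linear_simps eq_neg_iff_add_eq_0 add.commute)
    then have "snd z = 0" using z by (intro triv) auto
    then show "z = 0" using z inj[of "fst z"] by (simp add: prod_eq_iff)
  qed
  then obtain c where c: "c > 0" "\<forall>z\<in>?D. c * norm z \<le> norm (?S z)" by blast
  have "c * norm x \<le> norm (S x)" for x
    using c(2)[rule_format, of "(x, 0)"] by (simp add: complex_vector.span_zero)
  then show ?thesis using c(1) unfolding bounded_below_def by blast
qed

lemma bounded_below_closed_range:
  fixes S :: "'a::complex_banach \<Rightarrow> 'b::complex_banach"
  assumes S: "bounded_clinear S" and inj: "\<And>x. S x = 0 \<Longrightarrow> x = 0" and cl: "closed (range S)"
  shows "bounded_below S"
  using bounded_inverse_on_subspace[OF bounded_clinearD(1)[OF S] subspace_UNIV closed_UNIV inj cl]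
  by (auto simp: bounded_below_def)

lemma bounded_below_inj:
  assumes "bounded_below S" "S x = 0" shows "x = 0"
proof -
  obtain c where "c > 0" "c * norm x \<le> norm (S x)" using assms(1) unfolding bounded_below_def by blast
  then show ?thesis using assms(2) by (simp add: mult_le_0_iff)
qed

lemma upper_semi_Fredholm_bounded_below:
  assumes S: "bounded_clinear S" and bb: "bounded_below S"
  shows "upper_semi_Fredholm S"
proof -
  obtain c where "c > 0" "\<forall>x\<in>UNIV. norm (S x) \<ge> c * norm x" using bb unfolding bounded_below_def by blast
  then have "complete (range S)"
    using bounded_clinearD(1)[OF S] by (intro complete_isometric_image[of c]) (auto simp: complete_UNIV)
  moreover have "{x. S x = 0} = {0}"
    using bounded_below_inj[OF bb] bounded_clinearD(4)[OF S] by auto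
  moreover have "fin_dim {0 :: 'a}"
    unfolding fin_dim_def by (intro exI[of _ "{}"]) simp
  ultimately show ?thesis
    using S complete_imp_closed unfolding upper_semi_Fredholm_def by metis
qed

lemma bounded_below_compose:
  assumes "bounded_below S" "bounded_below T"
  shows "bounded_below (S \<circ> T)"
proof -
  obtain c where c: "c > 0" "\<And>x. c * norm x \<le> norm (S x)"
    using assms(1) unfolding bounded_below_def by blast
  obtain d where d: "d > 0" "\<And>x. d * norm x \<le> norm (T x)"
    using assms(2) unfolding bounded_below_def by blast
  have "c * d * norm x \<le> norm (S (T x))" for x
    using order_trans[OF mult_left_mono[OF d(2)[of x], of c] c(2)[of "T x"]] c(1) by (simp add: mult.assoc)
  then show ?thesis
    unfolding bounded_below_def using c d by (intro exI[of _ "c * d"]) simp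
qed

lemma bounded_below_factor:
  assumes "bounded_below (R \<circ> S)" "bounded_linear R"
  shows "bounded_below S"
proof -
  obtain c where c: "c > 0" "\<And>x. c * norm x \<le> norm (R (S x))"
    using assms(1) unfolding bounded_below_def o_apply by blast
  obtain K where K: "K > 0" "\<And>x. norm (R x) \<le> norm x * K"
    using bounded_linear.pos_bounded[OF assms(2)] by blast
  have "c / K * norm x \<le> norm (S x)" for x
    using order_trans[OF c(2)[of x] K(2)[of "S x"]] K(1) by (simp add: field_simps)
  then show ?thesis
    unfolding bounded_below_def using c K by (intro exI[of _ "c / K"]) simp
qed

lemma approx_point_spectrum_iff:
  assumes T: "bounded_clinear T"
  shows "\<mu> \<in> approx_point_spectrum T \<longleftrightarrow> \<not> bounded_below (shifted \<mu> T)"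
proof
  assume "\<mu> \<in> approx_point_spectrum T"
  then obtain x where x: "\<And>n. norm (x n) = 1" "(\<lambda>n. T (x n) - \<mu> *\<^sub>C x n) \<longlonglongrightarrow> 0"
    unfolding approx_point_spectrum_def by blast
  show "\<not> bounded_below (shifted \<mu> T)"
  proof
    assume "bounded_below (shifted \<mu> T)"
    then obtain c where c: "c > 0" "\<And>x. c * norm x \<le> norm (shifted \<mu> T x)" unfolding bounded_below_def by blast
    have "c \<le> norm (T (x n) - \<mu> *\<^sub>C x n)" for n
      using c(2)[of "x n"] x(1)[of n] by (simp add: shifted_def norm_minus_commute)
    then have "c \<le> norm (0 :: 'a)"
      using tendsto_norm[OF x(2)] by (intro LIMSEQ_le_const[of _ _ c]) auto
    then show False using c by simp
  qed
next
  assume nb: "\<not> bounded_below (shifted \<mu> T)"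
  have "\<exists>x. norm x = 1 \<and> norm (shifted \<mu> T x) < 1 / real (Suc n)" for n
  proof -
    obtain x where x: "norm (shifted \<mu> T x) < 1 / real (Suc n) * norm x"
      using nb unfolding bounded_below_def not_ex de_Morgan_conj not_all not_le
      by (elim allE[of _ "1 / real (Suc n)"]) auto
    then have x0: "x \<noteq> 0" using bounded_clinearD(4)[OF bounded_clinear_shifted[OF T]] by auto
    define y where "y = complex_of_real (inverse (norm x)) *\<^sub>C x"
    have yn: "cmod (complex_of_real (inverse (norm x))) = inverse (norm x)" by (simp add: norm_inverse)
    then have "norm y = 1" using x0 by (simp add: y_def norm_scaleC)
    moreover have "norm (shifted \<mu> T y) = inverse (norm x) * norm (shifted \<mu> T x)"
      by (simp only: y_def bounded_clinearD(5)[OF bounded_clinear_shifted[OF T]] norm_scaleC yn)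
    then have "norm (shifted \<mu> T y) < 1 / real (Suc n)"
      using mult_strict_left_mono[OF x, of "inverse (norm x)"] x0 by simp
    ultimately show ?thesis by blast
  qed
  then obtain x where x: "\<And>n. norm (x n) = 1" "\<And>n. norm (shifted \<mu> T (x n)) < 1 / real (Suc n)" by metis
  have "(\<lambda>n. T (x n) - \<mu> *\<^sub>C x n) \<longlonglongrightarrow> 0"
  proof (rule Lim_null_comparison[OF always_eventually])
    show "\<forall>n. norm (T (x n) - \<mu> *\<^sub>C x n) \<le> 1 / real (Suc n)"
      using x(2) by (metis less_imp_le norm_minus_commute shifted_def)
    show "(\<lambda>n. 1 / real (Suc n)) \<longlonglongrightarrow> 0"
      using LIMSEQ_inverse_real_of_nat by (simp add: inverse_eq_divide)
  qed
  then show "\<mu> \<in> approx_point_spectrum T" using x(1) unfolding approx_point_spectrum_def by blast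
qed

text \<open>The inverse of a surjective operator that is bounded below is bounded.\<close>

lemma not_in_spectrum:
  assumes T: "bounded_clinear T" and bb: "bounded_below (shifted \<mu> T)" and surj: "surj (shifted \<mu> T)"
  shows "\<mu> \<notin> spectrum T"
proof -
  let ?S = "shifted \<mu> T"
  note S = bounded_clinear_shifted[OF T, of \<mu>]
  have inj: "inj ?S"
  proof (rule injI)
    fix x y assume "?S x = ?S y"
    then show "x = y" using bounded_below_inj[OF bb, of "x - y"] by (simp add: bounded_clinearD[OF S])
  qed
  obtain c where c: "c > 0" "\<And>x. c * norm x \<le> norm (?S x)" using bb unfolding bounded_below_def by blast
  have r: "?S (inv ?S x) = x" for x using surj by (rule surj_f_inv_f)
  have "bounded_clinear (inv ?S)"
  proof (rule bounded_clinearI)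
    show "inv ?S (x + y) = inv ?S x + inv ?S y" for x y
      by (rule injD[OF inj]) (simp add: bounded_clinearD(2)[OF S] r)
    show "inv ?S (a *\<^sub>C x) = a *\<^sub>C inv ?S x" for a x
      by (rule injD[OF inj]) (simp add: bounded_clinearD(5)[OF S] r)
    show "norm (inv ?S x) \<le> norm x * inverse c" for x
      using c(2)[of "inv ?S x"] c(1) by (simp add: r field_simps)
  qed
  moreover have "inv ?S \<circ> ?S = id" "?S \<circ> inv ?S = id"
    using inj surj by (auto simp: surj_iff)
  ultimately show ?thesis by (auto simp: spectrum_def)
qed

lemma lower_semi_Fredholm_subset_spectrum: "bounded_clinear T \<Longrightarrow> lower_semi_Fredholm_spectrum T \<subseteq> spectrum T"
proof
  fix \<mu> assume T: "bounded_clinear T" and "\<mu> \<in> lower_semi_Fredholm_spectrum T"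
  then have nf: "\<not> fin_codim (range (shifted \<mu> T))"
    using bounded_clinear_shifted by (auto simp: lower_semi_Fredholm_spectrum_def lower_semi_Fredholm_def)
  show "\<mu> \<in> spectrum T"
  proof (rule ccontr)
    assume "\<mu> \<notin> spectrum T"
    then obtain S where "shifted \<mu> T \<circ> S = id" by (auto simp: spectrum_def)
    then have "range (shifted \<mu> T) = UNIV" by (metis surj_def comp_apply id_apply)
    then show False using nf by (auto simp: fin_codim_def intro!: exI[of _ "{}"])
  qed
qed

section \<open>Polynomials in an operator\<close>

text \<open>The polynomial \<open>p\<close> evaluated at the operator \<open>T\<close>, in Horner
  form.\<close>

definition poly_op :: "complex poly \<Rightarrow> ('a::complex_normed_vector \<Rightarrow> 'a) \<Rightarrow> 'a \<Rightarrow> 'a" where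
  "poly_op p T x = fold_coeffs (\<lambda>a y. a *\<^sub>C x + T y) p 0"

lemma poly_op_0 [simp]: "poly_op 0 T x = 0"
  by (simp add: poly_op_def)

lemma poly_op_pCons:
  assumes "bounded_clinear T"
  shows "poly_op (pCons a p) T x = a *\<^sub>C x + T (poly_op p T x)"
  by (cases "p = 0 \<and> a = 0") (auto simp: poly_op_def bounded_clinearD[OF assms])

lemma poly_op_add:
  assumes "bounded_clinear T"
  shows "poly_op (p + q) T x = poly_op p T x + poly_op q T x"
  by (induction p q rule: poly_induct2)
    (auto simp: poly_op_pCons[OF assms] bounded_clinearD[OF assms] scaleC_add_left)

lemma poly_op_smult:
  assumes "bounded_clinear T"
  shows "poly_op (smult c p) T x = c *\<^sub>C poly_op p T x"
  by (induction p) (auto simp: poly_op_pCons[OF assms] bounded_clinearD[OF assms] scaleC_add_right scaleC_scaleC)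

lemma poly_op_mult:
  assumes "bounded_clinear T"
  shows "poly_op (p * q) T x = poly_op p T (poly_op q T x)"
  by (induction p)
    (auto simp: poly_op_pCons[OF assms] poly_op_add[OF assms] poly_op_smult[OF assms])

lemma poly_op_monom:
  assumes "bounded_clinear T"
  shows "poly_op (monom 1 n) T x = (T ^^ n) x"
  by (induction n) (auto simp: monom_0 monom_Suc poly_op_pCons[OF assms] bounded_clinearD[OF assms])

lemma bounded_clinear_poly_op:
  assumes "bounded_clinear T"
  shows "bounded_clinear (poly_op p T)"
proof (induction p)
  case 0
  show ?case by (rule bounded_clinearI[of _ 0]) auto
next
  case (pCons a p)
  show ?case
    unfolding poly_op_pCons[OF assms]
    using bounded_clinear_compose[OF assms pCons(2)]
    by (intro bounded_clinear_add bounded_clinear_scaleC) (simp add: o_def)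
qed

lemma shifted_power_poly_op:
  assumes T: "bounded_clinear T" and m: "m \<ge> 1"
  obtains p where "p \<noteq> 0" "\<And>z. poly p z = \<mu> ^ m - z ^ m" "poly_op p T = shifted (\<mu> ^ m) (T ^^ m)"
proof (rule that[of "[:\<mu> ^ m:] + smult (-1) (monom 1 m)"])
  let ?p = "[:\<mu> ^ m:] + smult (-1) (monom 1 m)"
  have "coeff ?p m = - 1" using m by (cases m) auto
  then show "?p \<noteq> 0" by (metis coeff_0 neg_equal_0_iff_equal zero_neq_one)
  show "poly ?p z = \<mu> ^ m - z ^ m" for z by (simp add: poly_monom)
  show "poly_op ?p T = shifted (\<mu> ^ m) (T ^^ m)"
    by (rule ext) (simp only: poly_op_add[OF T] poly_op_smult[OF T] poly_op_monom[OF T],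
        simp add: poly_op_pCons[OF T] shifted_def bounded_clinearD[OF T])
qed

text \<open>The factor is written \<open>z - X\<close>, since \<open>shifted z T\<close> is \<open>z
  - T\<close>.\<close>

lemma linear_factor:
  fixes p :: "complex poly"
  assumes "poly p z = 0"
  obtains r where "p = [:z, - 1:] * r"
proof -
  obtain r where "p = [:- z, 1:] * r" using assms unfolding poly_eq_0_iff_dvd by (elim dvdE)
  then have "p = [:z, - 1:] * (- r)" by simp
  then show ?thesis by (rule that)
qed

lemma poly_op_linear:
  assumes "bounded_clinear T"
  shows "poly_op [:z, - 1:] T = shifted z T"
  by (rule ext) (simp add: poly_op_pCons[OF assms] shifted_def bounded_clinearD[OF assms])

text \<open>Since \<open>\<mu>\<close> is a root of \<open>\<mu> ^ m - X ^ m\<close>, the operator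
  \<open>\<mu> - T\<close> is a factor of \<open>\<mu> ^ m - T ^ m\<close> from both sides.\<close>

lemma shifted_power_factor:
  assumes T: "bounded_clinear T" and m: "m \<ge> 1"
  obtains R where "bounded_clinear R"
    "\<And>x. shifted (\<mu> ^ m) (T ^^ m) x = shifted \<mu> T (R x)"
    "\<And>x. shifted (\<mu> ^ m) (T ^^ m) x = R (shifted \<mu> T x)"
proof -
  obtain p where p: "\<And>z. poly p z = \<mu> ^ m - z ^ m" "poly_op p T = shifted (\<mu> ^ m) (T ^^ m)"
    using shifted_power_poly_op[OF T m] by metis
  obtain r where r: "p = [:\<mu>, - 1:] * r" using linear_factor[of p \<mu>] p(1) by auto
  show ?thesis
  proof (rule that[of "poly_op r T"])
    show "shifted (\<mu> ^ m) (T ^^ m) x = shifted \<mu> T (poly_op r T x)" for x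
      unfolding p(2)[symmetric] r by (simp only: poly_op_mult[OF T] poly_op_linear[OF T])
    show "shifted (\<mu> ^ m) (T ^^ m) x = poly_op r T (shifted \<mu> T x)" for x
      unfolding p(2)[symmetric] r mult.commute[of _ r]
      by (simp only: poly_op_mult[OF T] poly_op_linear[OF T])
  qed (rule bounded_clinear_poly_op[OF T])
qed

text \<open>By the fundamental theorem of algebra \<open>\<mu> ^ m - T ^ m\<close> is, up to a
  scalar, a product of operators \<open>z - T\<close> with \<open>z ^ m = \<mu> ^ m\<close>. A
  property that is stable under products therefore passes from all these factors to \<open>\<mu> ^ m
  - T ^ m\<close>.\<close>

lemma shifted_power_induct:
  assumes T: "bounded_clinear T"
    and lin: "\<And>z. z ^ m = \<mu> ^ m \<Longrightarrow> Q (shifted z T)"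
    and comp: "\<And>S S'. bounded_clinear S \<Longrightarrow> bounded_clinear S' \<Longrightarrow> Q S \<Longrightarrow> Q S' \<Longrightarrow> Q (S \<circ> S')"
    and const: "\<And>c. c \<noteq> 0 \<Longrightarrow> Q (\<lambda>x. c *\<^sub>C x)" and m: "m \<ge> 1"
  shows "Q (shifted (\<mu> ^ m) (T ^^ m))"
proof -
  have "Q (poly_op p T)" if "p \<noteq> 0" "\<And>z. poly p z = 0 \<Longrightarrow> z ^ m = \<mu> ^ m" for p
    using that
  proof (induction "degree p" arbitrary: p)
    case 0
    then obtain c where "p = [:c:]" "c \<noteq> 0" by (metis degree_eq_zeroE pCons_0_0)
    moreover have "poly_op [:c:] T = (\<lambda>x. c *\<^sub>C x)"
      by (rule ext) (simp add: poly_op_pCons[OF T] bounded_clinearD[OF T])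
    ultimately show ?case using const by simp
  next
    case (Suc n)
    then have "\<not> constant (poly p)" by (simp add: constant_degree)
    then obtain z where z: "poly p z = 0" using Fundamental_Theorem_Algebra.fundamental_theorem_of_algebra by blast
    then obtain r where r: "p = [:z, - 1:] * r" by (rule linear_factor)
    then have "r \<noteq> 0" using Suc.prems by auto
    then have "degree p = Suc (degree r)" unfolding r by (subst degree_mult_eq) auto
    then have "Q (poly_op r T)"
      using Suc.hyps Suc.prems(2) \<open>r \<noteq> 0\<close> by (intro Suc.hyps(1)) (auto simp: r)
    moreover have "poly_op p T = shifted z T \<circ> poly_op r T"
      unfolding r by (rule ext) (simp only: poly_op_mult[OF T] poly_op_linear[OF T] o_apply)
    ultimately show ?case
      using comp[OF bounded_clinear_shifted[OF T] bounded_clinear_poly_op[OF T]] lin[OF Suc.prems(2)[OF z]] by simp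
  qed
  then show ?thesis using shifted_power_poly_op[OF T m, of \<mu>] by (metis eq_iff_diff_eq_0)
qed

section \<open>Multiplication and dilation as operators\<close>

lemma dilate_mem:
  "cmod a \<le> 1 \<Longrightarrow> cmod b \<le> 1 \<Longrightarrow> z \<in> closed_bidisc \<Longrightarrow> (a * fst z, b * snd z) \<in> closed_bidisc"
  using mult_mem_disc(2) by (auto simp: mem_Times_iff)

lemma dilate_hom:
  assumes ab: "cmod a \<le> 1" "cmod b \<le> 1"
  shows "dilate a b 0 = 0" "dilate a b 1 = 1" "dilate a b (f + g) = dilate a b f + dilate a b g"
    "dilate a b (f - g) = dilate a b f - dilate a b g"
    "dilate a b (c *\<^sub>C f) = c *\<^sub>C dilate a b f"
    "dilate a b (f * g) = dilate a b f * dilate a b g"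
  using dilate_mem[OF ab] by (auto intro!: bd_eqI simp: ab)

lemma dilate_sum:
  assumes "cmod a \<le> 1" "cmod b \<le> 1"
  shows "dilate a b (sum f A) = (\<Sum>x\<in>A. dilate a b (f x))"
  by (induction A rule: infinite_finite_induct) (auto simp: dilate_hom[OF assms])

lemma dilate_prod:
  assumes "cmod a \<le> 1" "cmod b \<le> 1"
  shows "dilate a b (prod f A) = (\<Prod>x\<in>A. dilate a b (f x))"
  by (induction A rule: infinite_finite_induct) (auto simp: dilate_hom[OF assms])

lemma dilate_power:
  assumes "cmod a \<le> 1" "cmod b \<le> 1"
  shows "dilate a b (f ^ n) = dilate a b f ^ n"
  by (induction n) (auto simp: dilate_hom[OF assms])

lemma dilate_dilate:
  assumes "cmod a \<le> 1" "cmod b \<le> 1" "cmod c \<le> 1" "cmod d \<le> 1"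
  shows "dilate a b (dilate c d f) = dilate (a * c) (b * d) f"
proof (rule bd_eqI)
  fix z :: "complex \<times> complex" assume z: "z \<in> closed_bidisc"
  have "cmod (a * c) \<le> 1" "cmod (b * d) \<le> 1"
    using assms by (auto simp: norm_mult mult_le_one)
  then show "bd_apply (dilate a b (dilate c d f)) z = bd_apply (dilate (a * c) (b * d) f) z"
    using z assms dilate_mem[OF assms(1,2) z] by (simp add: mult_ac)
qed

lemma dilate_one [simp]: "dilate 1 1 f = f"
  by (rule bd_eqI) simp

lemma dilate_coord:
  assumes "cmod a \<le> 1" "cmod b \<le> 1"
  shows "dilate a b coord1 = a *\<^sub>C coord1" "dilate a b coord2 = b *\<^sub>C coord2"
  using dilate_mem[OF assms] by (auto intro!: bd_eqI simp: assms)

lemma norm_dilate: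
  assumes "cmod a \<le> 1" "cmod b \<le> 1"
  shows "norm (dilate a b f) \<le> norm f"
  by (rule bd_norm_least) (use dilate_mem[OF assms] in \<open>auto simp: assms intro!: bd_norm_upper\<close>)

lemma bounded_clinear_times: "bounded_clinear ((*) (g :: bidisc_algebra))"
proof (rule bounded_clinearI)
  show "norm (g * f) \<le> norm f * norm g" for f
    using norm_times_bd[of g f] by (simp only: mult.commute)
qed (simp_all add: distrib_left)

lemma bounded_clinear_weighted_dilate:
  assumes "cmod a \<le> 1" "cmod b \<le> 1"
  shows "bounded_clinear (\<lambda>f. w * dilate a b f)"
proof (rule bounded_clinearI)
  show "norm (w * dilate a b f) \<le> norm f * norm w" for f
    using order_trans[OF norm_times_bd[of w "dilate a b f"] mult_left_mono[OF norm_dilate[OF assms, of f] norm_ge_zero[of w]]]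
    by (simp add: mult.commute)
qed (auto simp: dilate_hom[OF assms] distrib_left)

section \<open>Polynomials in a coordinate\<close>

lemma polynomial_vanishing_on_infinite_set:
  fixes c :: "nat \<Rightarrow> complex"
  assumes "infinite S" "\<And>x. x \<in> S \<Longrightarrow> (\<Sum>i\<le>n. c i * x ^ i) = 0" "i \<le> n"
  shows "c i = 0"
proof -
  have "S \<subseteq> {x. (\<Sum>i\<le>n. c i * x ^ i) = 0}" using assms by auto
  then have "infinite {x. (\<Sum>i\<le>n. c i * x ^ i) = 0}" using assms(1) finite_subset by blast
  then show ?thesis using polyfun_finite_roots[of c n] assms(3) by blast
qed

text \<open>Evaluated on the diagonal, the relation is a polynomial in \<open>x = y ^ m\<close>, and
  \<open>x\<close> runs through all of \<open>[0, 1]\<close>.\<close>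

lemma coord_power_independent:
  assumes X: "X \<in> {coord1, coord2}" and m: "m \<ge> 1"
    and zero: "(\<Sum>i\<le>n. c i *\<^sub>C (X ^ m) ^ i) = 0" and i: "i \<le> n"
  shows "c i = 0"
proof (rule polynomial_vanishing_on_infinite_set[OF _ _ i])
  show "infinite (complex_of_real ` {0..1})"
    by (simp add: finite_image_iff inj_on_def infinite_Icc)
  fix x assume "x \<in> complex_of_real ` {0..1}"
  then obtain t where t: "x = of_real t" "0 \<le> t" "t \<le> 1" by auto
  define y where "y = complex_of_real (root m t)"
  have "y ^ m = x" using t m by (simp add: y_def flip: of_real_power)
  moreover have "(y, y) \<in> closed_bidisc" using t m by (auto simp: y_def)
  ultimately have "bd_apply (\<Sum>i\<le>n. c i *\<^sub>C (X ^ m) ^ i) (y, y) = (\<Sum>i\<le>n. c i * x ^ i)"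
    using X by auto
  then show "(\<Sum>i\<le>n. c i * x ^ i) = 0" using zero by simp
qed

text \<open>Infinitely many zeros of \<open>g\<close> have infinitely many different values of one
  of the coordinates, say \<open>X\<close>. If the ideal of multiples of \<open>g\<close> had finite
  codimension, it would contain a nonzero polynomial in \<open>X\<close>, which would vanish at all
  those values.\<close>

lemma infinite_zeros_imp_not_fin_codim:
  assumes inf: "infinite {z \<in> closed_bidisc. bd_apply g z = 0}"
  shows "\<not> fin_codim (range ((*) g))"
proof
  assume fc: "fin_codim (range ((*) g))"
  let ?Z = "{z \<in> closed_bidisc. bd_apply g z = 0}"
  have "?Z \<subseteq> fst ` ?Z \<times> snd ` ?Z" by force
  then have "infinite (fst ` ?Z) \<or> infinite (snd ` ?Z)"
    using inf finite_subset by blast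
  then have "\<exists>X \<pi>. (\<forall>z\<in>closed_bidisc. bd_apply X z = \<pi> z) \<and> infinite (\<pi> ` ?Z)"
  proof
    assume "infinite (fst ` ?Z)"
    then show ?thesis by (intro exI[of _ coord1] exI[of _ fst]) simp
  next
    assume "infinite (snd ` ?Z)"
    then show ?thesis by (intro exI[of _ coord2] exI[of _ snd]) simp
  qed
  then obtain X \<pi> where X: "\<And>z. z \<in> closed_bidisc \<Longrightarrow> bd_apply X z = \<pi> z" and \<pi>: "infinite (\<pi> ` ?Z)"
    by blast
  obtain B where B: "finite B" "\<And>x. \<exists>y\<in>range ((*) g). \<exists>b\<in>complex_vector.span B. x = y + b"
    using fc unfolding fin_codim_iff[OF subspace_range[OF bounded_clinear_times]] by meson
  note sub = subspace_range[OF bounded_clinear_times[of g]]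
  from nontrivial_combination[OF sub B(1), of "\<lambda>i. X ^ i", OF B(2)]
  obtain n c where c: "\<exists>i\<le>n. c i \<noteq> 0" "(\<Sum>i\<le>n. c i *\<^sub>C X ^ i) \<in> range ((*) g)"
    by meson
  then obtain h where h: "(\<Sum>i\<le>n. c i *\<^sub>C X ^ i) = g * h" by auto
  have "(\<Sum>i\<le>n. c i * x ^ i) = 0" if x: "x \<in> \<pi> ` ?Z" for x
  proof -
    obtain z where z: "z \<in> ?Z" "x = \<pi> z" using x by auto
    have "bd_apply (\<Sum>i\<le>n. c i *\<^sub>C X ^ i) z = 0" unfolding h using z by simp
    then show ?thesis using z X by simp
  qed
  then show False using polynomial_vanishing_on_infinite_set[OF \<pi>] c(1) by blast
qed

section \<open>Roots of unity\<close>

lemma primitive_root_norm: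
  assumes "primitive_root_of_unity n a"
  shows "cmod a = 1"
proof -
  have "cmod a ^ n = 1 ^ n" "n > 0"
    using assms by (auto simp: primitive_root_of_unity_def simp flip: norm_power)
  then show ?thesis using power_eq_imp_eq_base[of "cmod a" n 1] by simp
qed

text \<open>The powers \<open>a ^ i\<close> with \<open>i < n\<close> are \<open>n\<close> different
  roots of unity, and there are no more.\<close>

lemma root_of_unity_is_power:
  assumes a: "primitive_root_of_unity n a" and z: "z ^ n = 1"
  shows "\<exists>i. z = a ^ i"
proof -
  have a0: "a \<noteq> 0" using primitive_root_norm[OF a] by auto
  have n: "n > 0" "a ^ n = 1" "\<And>k. 1 \<le> k \<Longrightarrow> k < n \<Longrightarrow> a ^ k \<noteq> 1"
    using a by (auto simp: primitive_root_of_unity_def)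
  have neq: "a ^ i \<noteq> a ^ j" if "i < j" "j < n" for i j
  proof
    assume "a ^ i = a ^ j"
    then have "a ^ (j - i) = 1" using that a0 by (simp add: power_diff)
    then show False using n(3)[of "j - i"] that by simp
  qed
  have "inj_on (\<lambda>i. a ^ i) {..<n}"
    by (rule inj_onI) (metis lessThan_iff linorder_neqE_nat neq)
  then have "card ((\<lambda>i. a ^ i) ` {..<n}) = n" by (simp add: card_image)
  moreover have "(\<lambda>i. a ^ i) ` {..<n} \<subseteq> {z. z ^ n = 1}"
    using n(2) by (auto simp: power_commutes simp flip: power_mult) (metis mult.commute power_mult power_one)
  ultimately have "(\<lambda>i. a ^ i) ` {..<n} = {z. z ^ n = 1}"
    using n(1) by (intro card_subset_eq) (auto simp: card_roots_unity_eq finite_roots_unity)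
  then show ?thesis using z by blast
qed

text \<open>With \<open>r = lcm p q div p\<close> and \<open>s = lcm p q div q\<close>, the power
  \<open>z ^ r\<close> is a \<open>p\<close>-th and \<open>z ^ s\<close> a \<open>q\<close>-th root
  of unity. As \<open>r\<close> and \<open>s\<close> are coprime, a Bezout relation recovers
  \<open>z\<close> from these two powers.\<close>

lemma root_of_unity_lcm:
  assumes a: "primitive_root_of_unity p a" and b: "primitive_root_of_unity q b"
    and z: "z ^ lcm p q = 1"
  shows "\<exists>i j. z = a ^ i * b ^ j"
proof -
  have pq: "p > 0" "q > 0" using a b by (auto simp: primitive_root_of_unity_def)
  define r where "r = q div gcd p q"
  define s where "s = p div gcd p q"
  have rs: "r * p = lcm p q" "s * q = lcm p q"
    by (simp_all add: r_def s_def lcm_nat_def div_mult_swap dvd_div_mult mult.commute)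
  have "coprime r s" unfolding r_def s_def
    using pq by (metis coprime_commute div_gcd_coprime less_numeral_extra(3))
  moreover have "r \<noteq> 0" using rs(1) lcm_pos_nat[OF pq] by (metis less_irrefl mult_zero_left)
  ultimately obtain x y where xy: "r * x = s * y + 1"
    using bezout_nat[of r s] by auto
  obtain i where i: "z ^ r = a ^ i"
    using root_of_unity_is_power[OF a, of "z ^ r"] z rs by (auto simp flip: power_mult)
  obtain j where j: "z ^ s = b ^ j"
    using root_of_unity_is_power[OF b, of "z ^ s"] z rs by (auto simp flip: power_mult)
  \<comment> \<open>As \<open>z ^ s\<close> is a \<open>q\<close>-th root of unity, its power
    \<open>y * (q - 1)\<close> inverts its power \<open>y\<close>.\<close>
  have exponent: "y * (q - 1) + y = q * y" using pq by (cases q) auto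
  have "(z ^ s) ^ q = 1" using z rs by (simp flip: power_mult)
  then have 1: "(z ^ s) ^ (y * (q - 1)) * (z ^ s) ^ y = 1"
    unfolding power_add[symmetric] exponent power_mult[of "z ^ s" q y] by simp
  have "z = z * ((z ^ s) ^ (y * (q - 1)) * (z ^ s) ^ y)" using 1 by simp
  also have "\<dots> = z ^ (s * y + 1) * (z ^ s) ^ (y * (q - 1))"
    by (simp add: power_mult)
  also have "\<dots> = (a ^ i) ^ x * (b ^ j) ^ (y * (q - 1))"
    by (simp only: xy[symmetric] power_mult i j)
  finally show ?thesis by (metis power_mult)
qed

section \<open>Weighted rotation operators\<close>

locale weighted_rotation =
  fixes \<alpha>1 \<alpha>2 :: complex and p q m :: nat and w :: bidisc_algebra
    and T :: "bidisc_algebra \<Rightarrow> bidisc_algebra"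
  assumes root1: "primitive_root_of_unity p \<alpha>1" and root2: "primitive_root_of_unity q \<alpha>2"
    and m_def: "m = lcm p q"
    and T_def: "T = (\<lambda>f. w * dilate \<alpha>1 \<alpha>2 f)"
begin

text \<open>The cocycle of \<open>w\<close> as an element of the algebra.\<close>

definition weight :: "nat \<Rightarrow> bidisc_algebra" where
  "weight n = (\<Prod>k<n. dilate (\<alpha>1 ^ k) (\<alpha>2 ^ k) w)"

text \<open>The function whose zeros decide about \<open>\<mu>\<close>: multiplication by it is
  \<open>\<mu> ^ m - T ^ m\<close>.\<close>

definition symbol :: "complex \<Rightarrow> bidisc_algebra" where
  "symbol \<mu> = \<mu> ^ m *\<^sub>C 1 - weight m"

lemma norm_root [simp]: "cmod \<alpha>1 = 1" "cmod \<alpha>2 = 1"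
  using primitive_root_norm[OF root1] primitive_root_norm[OF root2] .

lemma root_nonzero: "\<alpha>1 \<noteq> 0" "\<alpha>2 \<noteq> 0"
  using norm_root by (metis norm_zero zero_neq_one)+

lemma m_pos: "m \<ge> 1"
  using root1 root2 lcm_pos_nat[of p q] unfolding m_def primitive_root_of_unity_def by simp

lemma root_power_m: "\<alpha>1 ^ m = 1" "\<alpha>2 ^ m = 1"
proof -
  have "\<alpha>1 ^ p = 1" "\<alpha>2 ^ q = 1" using root1 root2 by (auto simp: primitive_root_of_unity_def)
  moreover obtain k where "m = p * k" using dvd_lcm1[of p q] unfolding m_def by (rule dvdE)
  moreover obtain l where "m = q * l" using dvd_lcm2[of q p] unfolding m_def by (rule dvdE)
  ultimately show "\<alpha>1 ^ m = 1" "\<alpha>2 ^ m = 1" by (metis power_mult power_one)+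
qed

lemma T_apply: "T f = w * dilate \<alpha>1 \<alpha>2 f"
  by (simp add: T_def)

lemma T_bounded_clinear: "bounded_clinear T"
  unfolding T_def by (rule bounded_clinear_weighted_dilate) simp_all

lemma T_power: "(T ^^ n) f = weight n * dilate (\<alpha>1 ^ n) (\<alpha>2 ^ n) f"
proof (induction n)
  case (Suc n)
  have "dilate \<alpha>1 \<alpha>2 (weight n) = (\<Prod>k<n. dilate (\<alpha>1 ^ Suc k) (\<alpha>2 ^ Suc k) w)"
    by (simp add: weight_def dilate_prod dilate_dilate norm_power)
  then have "w * dilate \<alpha>1 \<alpha>2 (weight n) = weight (Suc n)"
    unfolding weight_def prod.lessThan_Suc_shift by simp
  moreover have "(T ^^ Suc n) f = w * dilate \<alpha>1 \<alpha>2 (weight n * dilate (\<alpha>1 ^ n) (\<alpha>2 ^ n) f)"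
    by (simp only: funpow.simps o_apply Suc T_apply)
  ultimately show ?case
    by (simp add: dilate_hom dilate_dilate norm_power mult.assoc[symmetric])
qed (simp add: weight_def)

lemma shifted_T_power: "shifted (\<mu> ^ m) (T ^^ m) = (*) (symbol \<mu>)"
  by (rule ext) (simp add: shifted_def T_power root_power_m symbol_def left_diff_distrib)

lemma bounded_below_shifted:
  assumes "\<And>t. t \<in> torus \<Longrightarrow> bd_apply (symbol \<mu>) t \<noteq> 0"
  shows "bounded_below (shifted \<mu> T)"
proof -
  obtain R where R: "bounded_clinear R" "\<And>x. shifted (\<mu> ^ m) (T ^^ m) x = R (shifted \<mu> T x)"
    using shifted_power_factor[OF T_bounded_clinear m_pos] by metis
  have "bounded_below (R \<circ> shifted \<mu> T)"
    using times_bounded_below[OF assms] by (simp add: bounded_below_def R(2)[symmetric] shifted_T_power)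
  then show ?thesis by (rule bounded_below_factor[OF _ bounded_clinearD(1)[OF R(1)]])
qed

text \<open>If the symbol is invertible, then \<open>\<mu> ^ m - T ^ m\<close> is surjective, hence
  so is its left factor \<open>\<mu> - T\<close>.\<close>

lemma not_in_spectrum_T:
  assumes nz: "\<And>t. t \<in> closed_bidisc \<Longrightarrow> bd_apply (symbol \<mu>) t \<noteq> 0"
  shows "\<mu> \<notin> spectrum T"
proof (rule not_in_spectrum[OF T_bounded_clinear])
  show "bounded_below (shifted \<mu> T)"
    by (rule bounded_below_shifted) (use nz in auto)
  obtain R where R: "\<And>x. shifted (\<mu> ^ m) (T ^^ m) x = shifted \<mu> T (R x)"
    using shifted_power_factor[OF T_bounded_clinear m_pos] by metis
  obtain h where h: "symbol \<mu> * h = 1" using bd_unit[OF nz] by blast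
  have "y = shifted \<mu> T (R (h * y))" for y
    using R[of "h * y"] h by (simp add: shifted_T_power mult.assoc[symmetric])
  then show "surj (shifted \<mu> T)" by (rule surjI[OF sym])
qed

text \<open>Dividing by \<open>\<alpha>1\<close> and \<open>\<alpha>2\<close> leads from
  \<open>\<mu>\<close> to every number with the same \<open>m\<close>-th power, because
  \<open>\<alpha>1\<close> and \<open>\<alpha>2\<close> generate the \<open>m\<close>-th roots of
  unity. For \<open>\<mu> = 0\<close> there is nothing to move.\<close>

lemma eigenvalue_orbit:
  assumes base: "P \<mu>" and step1: "\<And>\<nu>. \<nu> \<noteq> 0 \<Longrightarrow> P \<nu> \<Longrightarrow> P (\<nu> / \<alpha>1)"
    and step2: "\<And>\<nu>. \<nu> \<noteq> 0 \<Longrightarrow> P \<nu> \<Longrightarrow> P (\<nu> / \<alpha>2)" and \<nu>: "\<nu> ^ m = \<mu> ^ m"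
  shows "P \<nu>"
proof (cases "\<mu> = 0")
  case True
  then show ?thesis using base \<nu> m_pos by (simp add: power_0_left)
next
  case False
  have 1: "P (\<mu> / \<alpha>1 ^ i)" for i
  proof (induction i)
    case (Suc i)
    then show ?case using step1[of "\<mu> / \<alpha>1 ^ i"] False root_nonzero by (simp add: mult.commute)
  qed (use base in simp)
  have 2: "P (\<mu> / \<alpha>1 ^ i / \<alpha>2 ^ j)" for i j
  proof (induction j)
    case (Suc j)
    then show ?case using step2[of "\<mu> / \<alpha>1 ^ i / \<alpha>2 ^ j"] False root_nonzero by (simp add: mult_ac)
  qed (use 1 in simp)
  have \<nu>0: "\<nu> \<noteq> 0" using \<nu> False m_pos by (auto simp: power_0_left)
  have "(\<mu> / \<nu>) ^ lcm p q = 1" using \<nu> \<nu>0 False by (simp add: power_divide flip: m_def)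
  then obtain i j where "\<mu> / \<nu> = \<alpha>1 ^ i * \<alpha>2 ^ j"
    using root_of_unity_lcm[OF root1 root2] by blast
  then have "\<nu> = \<mu> / \<alpha>1 ^ i / \<alpha>2 ^ j" using \<nu>0 root_nonzero False by (simp add: field_simps)
  then show ?thesis using 2 by simp
qed

text \<open>Multiplication by a coordinate intertwines \<open>T\<close> with a rotated copy of
  itself; this is the source of the rotational symmetry of all the spectra.\<close>

lemma shifted_coord:
  shows "shifted \<nu> T (coord1 * f) = \<alpha>1 *\<^sub>C (coord1 * shifted (\<nu> / \<alpha>1) T f)"
    and "shifted \<nu> T (coord2 * f) = \<alpha>2 *\<^sub>C (coord2 * shifted (\<nu> / \<alpha>2) T f)"
proof -
  have "T (coord1 * f) = \<alpha>1 *\<^sub>C (coord1 * T f)" "T (coord2 * f) = \<alpha>2 *\<^sub>C (coord2 * T f)"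
    by (simp_all add: T_apply dilate_hom dilate_coord mult.left_commute[of w])
  then show "shifted \<nu> T (coord1 * f) = \<alpha>1 *\<^sub>C (coord1 * shifted (\<nu> / \<alpha>1) T f)"
    "shifted \<nu> T (coord2 * f) = \<alpha>2 *\<^sub>C (coord2 * shifted (\<nu> / \<alpha>2) T f)"
    using root_nonzero
    by (simp_all add: shifted_def right_diff_distrib scaleC_scaleC complex_vector.scale_right_diff_distrib)
qed

lemma bounded_below_step:
  assumes "bounded_below (shifted \<nu> T)"
  shows "bounded_below (shifted (\<nu> / \<alpha>1) T)" "bounded_below (shifted (\<nu> / \<alpha>2) T)"
proof -
  obtain c where c: "c > 0" "\<And>f. c * norm f \<le> norm (shifted \<nu> T f)"
    using assms unfolding bounded_below_def by blast
  show "bounded_below (shifted (\<nu> / \<alpha>1) T)"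
    using c(1) c(2)[of "coord1 * _"] unfolding bounded_below_def
    by (auto simp: shifted_coord norm_scaleC norm_coord_times)
  show "bounded_below (shifted (\<nu> / \<alpha>2) T)"
    using c(1) c(2)[of "coord2 * _"] unfolding bounded_below_def
    by (auto simp: shifted_coord norm_scaleC norm_coord_times)
qed

lemma bounded_below_const: "c \<noteq> 0 \<Longrightarrow> bounded_below (\<lambda>x :: bidisc_algebra. c *\<^sub>C x)"
  unfolding bounded_below_def by (intro exI[of _ "cmod c"]) (simp add: norm_scaleC)

text \<open>The symmetry makes all factors of \<open>\<mu> ^ m - T ^ m\<close> bounded below if one
  of them is, and then multiplication by the symbol would be bounded below.\<close>

lemma not_bounded_below_shifted:
  assumes t: "t \<in> torus" "bd_apply (symbol \<mu>) t = 0"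
  shows "\<not> bounded_below (shifted \<mu> T)"
proof
  assume bb: "bounded_below (shifted \<mu> T)"
  have "bounded_below (shifted (\<mu> ^ m) (T ^^ m))"
  proof (rule shifted_power_induct[OF T_bounded_clinear _ _ _ m_pos])
    show "bounded_below (shifted z T)" if "z ^ m = \<mu> ^ m" for z
      using eigenvalue_orbit[of "\<lambda>z. bounded_below (shifted z T)", OF bb _ _ that] bounded_below_step by blast
    show "bounded_below (S \<circ> S')" if "bounded_below S" "bounded_below S'"
      for S S' :: "bidisc_algebra \<Rightarrow> bidisc_algebra"
      by (rule bounded_below_compose[OF that])
    show "bounded_below (\<lambda>x :: bidisc_algebra. c *\<^sub>C x)" if "c \<noteq> 0" for c
      by (rule bounded_below_const[OF that])
  qed
  then obtain c where c: "c > 0" "\<And>f. c * norm f \<le> norm (symbol \<mu> * f)"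
    unfolding bounded_below_def shifted_T_power by blast
  obtain f where "norm f = 1" "norm (symbol \<mu> * f) < c"
    using times_not_bounded_below[OF t c(1)] by blast
  then show False using c(2)[of f] by simp
qed

text \<open>The symmetry for finite codimension. Let \<open>Z\<close> be one coordinate,
  \<open>X\<close> the other, and \<open>E\<close> the restriction to the axis \<open>Z = 0\<close>.
  By \<open>shiftZ\<close> and the preimage lemma for multiplication by \<open>Z\<close> it suffices
  that \<open>Z * h = (\<nu> - T) u\<close> forces \<open>Z dvd u\<close>, i.e. that the operator
  \<open>\<nu> - E T\<close> induced on the axis is injective. Suppose it had an eigenvector
  \<open>f\<close>. Then \<open>f\<close> times any polynomial in \<open>X ^ m\<close> is another
  one, and as the range has finite codimension some such \<open>F \<noteq> 0\<close> lies in the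
  range. This gives a Jordan chain \<open>F = (\<nu> - E T) u'\<close>, which is impossible since
  the \<open>m\<close>-th power of \<open>E T\<close> is multiplication by a function that the
  eigenvector forces to be the constant \<open>\<nu> ^ m\<close>.\<close>

lemma fin_codim_step:
  fixes Z X :: bidisc_algebra and a b \<beta> :: complex
  assumes split: "(Z, a, b, X, \<beta>) \<in> {(coord1, 0, 1, coord2, \<alpha>1), (coord2, 1, 0, coord1, \<alpha>2)}"
    and \<nu>: "\<nu> \<noteq> 0" and cod: "fin_codim (range (shifted \<nu> T))"
  shows "fin_codim (range (shifted (\<nu> / \<beta>) T))"
proof -
  define E where "E = dilate a b"
  define rot where "rot = dilate \<alpha>1 \<alpha>2"
  have ab: "cmod a \<le> 1" "cmod b \<le> 1" and \<beta>: "\<beta> \<noteq> 0" using split root_nonzero by auto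
  note E = dilate_hom[OF ab, folded E_def] and Esum = dilate_sum[OF ab, folded E_def]
  have EE: "E (E f) = E f" for f
    using split by (auto simp: E_def dilate_dilate)
  have Erot: "E (rot f) = rot (E f)" for f
    using split by (auto simp: E_def rot_def dilate_dilate)
  have EX: "E X = X" using split by (auto simp: E_def dilate_coord)
  have EXm: "E ((X ^ m) ^ i) = (X ^ m) ^ i" for i
    using dilate_power[OF ab] by (simp add: EX flip: E_def)
  have EZ: "E u = 0 \<Longrightarrow> Z dvd u" for u
    using split coord1_dvd coord2_dvd by (auto simp: E_def)
  have EZ0: "E Z = 0" using split by (auto simp: E_def dilate_coord)
  have Z0: "Z \<noteq> 0"
  proof
    assume "Z = 0"
    then have "bd_apply Z (1, 1) = 0" by simp
    then show False using split by auto
  qed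
  have rle: "cmod \<alpha>1 \<le> 1" "cmod \<alpha>2 \<le> 1" by simp_all
  note rot = dilate_hom[OF rle, folded rot_def] dilate_sum[OF rle, folded rot_def]
    dilate_power[OF rle, folded rot_def]
  have rotX: "rot X ^ m = X ^ m"
  proof -
    have "(c *\<^sub>C X) ^ m = c ^ m *\<^sub>C X ^ m" for c
      by (rule bd_eqI) (simp add: power_mult_distrib)
    then show ?thesis
      using split by (auto simp: rot_def dilate_coord root_power_m)
  qed
  have shiftZ: "shifted \<nu> T (Z * f) = \<beta> *\<^sub>C (Z * shifted (\<nu> / \<beta>) T f)" for f
    using split shifted_coord by auto
  have ET: "E (T f) = E (T (E f))" for f
    by (simp add: T_apply E Erot EE flip: rot_def)
  have T_smult: "E (T (u * f)) = u * E (T f)"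
    if "E u = u" "rot u = u" for u f
    using that by (simp add: T_apply E rot mult_ac flip: rot_def)
  have inj: "f = 0" if f: "E f = f" "E (T f) = \<nu> *\<^sub>C f" for f
  proof (rule ccontr)
    assume f0: "f \<noteq> 0"
    obtain B where B: "finite B" "\<And>x. \<exists>y\<in>range (shifted \<nu> T). \<exists>b\<in>complex_vector.span B. x = y + b"
      using cod unfolding fin_codim_iff[OF subspace_range[OF bounded_clinear_shifted[OF T_bounded_clinear]]] by meson
    obtain n c where c: "\<exists>i\<le>n. c i \<noteq> 0" "(\<Sum>i\<le>n. c i *\<^sub>C ((X ^ m) ^ i * f)) \<in> range (shifted \<nu> T)"
      using nontrivial_combination[OF subspace_range[OF bounded_clinear_shifted[OF T_bounded_clinear]] B(1),
          where v = "\<lambda>i. (X ^ m) ^ i * f", OF B(2)] by meson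
    define P where "P = (\<Sum>i\<le>n. c i *\<^sub>C (X ^ m) ^ i)"
    define F where "F = P * f"
    have "P \<noteq> 0" using coord_power_independent[of X m c n] split m_pos c(1) by (auto simp: P_def)
    then have F0: "F \<noteq> 0" using f0 by (simp add: F_def)
    have "F = (\<Sum>i\<le>n. c i *\<^sub>C ((X ^ m) ^ i * f))"
      by (simp add: F_def P_def sum_distrib_right)
    then obtain u where u: "F = shifted \<nu> T u" using c(2) by auto
    have EP: "E P = P"
      by (simp add: P_def Esum E EXm)
    have rotP: "rot P = P" by (simp add: P_def rot rotX)
    have EF: "E F = F" by (simp add: F_def E EP f)
    have ETF: "E (T F) = \<nu> *\<^sub>C F" by (simp add: F_def T_smult EP rotP f)
    \<comment> \<open>The eigenvector determines the \<open>m\<close>-th power of the induced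
      operator: it is the constant \<open>\<nu> ^ m\<close>.\<close>
    have pow: "E ((T ^^ k) f) = \<nu> ^ k *\<^sub>C f" for k
    proof (induction k)
      case (Suc k)
      have "E ((T ^^ Suc k) f) = E (T (E ((T ^^ k) f)))" using ET by simp
      also have "\<dots> = \<nu> ^ k *\<^sub>C E (T f)" by (simp add: Suc bounded_clinearD[OF T_bounded_clinear] E)
      finally show ?case by (simp add: f scaleC_scaleC mult.commute)
    qed (simp add: f)
    have "E (weight m) * f = \<nu> ^ m *\<^sub>C f"
      using pow[of m] f by (simp add: T_power root_power_m E)
    then have "(E (weight m) - \<nu> ^ m *\<^sub>C 1) * f = 0" by (simp add: left_diff_distrib)
    then have wm: "E (weight m) = \<nu> ^ m *\<^sub>C 1" using f0 by simp
    define u' where "u' = E u"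
    have "E F = \<nu> *\<^sub>C E u - E (T u)" by (simp add: u shifted_def E)
    then have Tu: "E (T u') = \<nu> *\<^sub>C u' - F" using ET[of u] by (simp add: EF u'_def)
    \<comment> \<open>Powers of a Jordan block; at \<open>k = m\<close> the off-diagonal entry has
      to vanish.\<close>
    have powu: "E ((T ^^ k) u') = \<nu> ^ k *\<^sub>C u' - (of_nat k * \<nu> ^ (k - 1)) *\<^sub>C F" for k
    proof (induction k)
      case 0
      then show ?case by (simp add: u'_def EE)
    next
      case (Suc k)
      have "E ((T ^^ Suc k) u') = E (T (E ((T ^^ k) u')))" using ET by simp
      also have "\<dots> = \<nu> ^ k *\<^sub>C E (T u') - (of_nat k * \<nu> ^ (k - 1)) *\<^sub>C E (T F)"
        by (simp add: Suc bounded_clinearD[OF T_bounded_clinear] E)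
      also have "\<dots> = \<nu> ^ Suc k *\<^sub>C u' - (\<nu> ^ k + of_nat k * \<nu> ^ (k - 1) * \<nu>) *\<^sub>C F"
        by (simp add: Tu ETF scaleC_scaleC complex_vector.scale_right_diff_distrib scaleC_add_left mult.commute)
      also have "\<nu> ^ k + of_nat k * \<nu> ^ (k - 1) * \<nu> = of_nat (Suc k) * \<nu> ^ (Suc k - 1)"
        by (cases k) (simp_all add: algebra_simps)
      finally show ?case .
    qed
    have "E ((T ^^ m) u') = \<nu> ^ m *\<^sub>C u'"
      by (simp add: T_power root_power_m E wm) (simp add: u'_def EE)
    then have "(of_nat m * \<nu> ^ (m - 1)) *\<^sub>C F = 0" using powu[of m] by simp
    then show False using F0 \<nu> m_pos by (simp add: complex_vector.scale_eq_0_iff)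
  qed
  show ?thesis
  proof (rule fin_codim_preimage[OF bounded_clinear_times[of Z] _ cod])
    fix h assume "Z * h \<in> range (shifted \<nu> T)"
    then obtain u where u: "Z * h = shifted \<nu> T u" by auto
    have "E (Z * h) = 0" by (simp add: E EZ0)
    then have "E (T (E u)) = \<nu> *\<^sub>C E u" using ET[of u] by (simp add: u shifted_def E)
    then have "E u = 0" by (intro inj EE)
    then obtain v where "u = Z * v" using EZ by (auto elim: dvdE)
    then have "Z * h = Z * shifted (\<nu> / \<beta>) T (\<beta> *\<^sub>C v)"
      using u shiftZ[of v] by (simp add: bounded_clinearD[OF bounded_clinear_shifted[OF T_bounded_clinear]])
    then have "h = shifted (\<nu> / \<beta>) T (\<beta> *\<^sub>C v)" using Z0 by simp
    then show "h \<in> range (shifted (\<nu> / \<beta>) T)" by simp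
  qed (intro subspace_range bounded_clinear_shifted T_bounded_clinear)+
qed

lemma fin_codim_const: "c \<noteq> 0 \<Longrightarrow> fin_codim (range (\<lambda>x :: bidisc_algebra. c *\<^sub>C x))"
proof -
  assume "c \<noteq> 0"
  then have "x = c *\<^sub>C (inverse c *\<^sub>C x)" for x :: bidisc_algebra by (simp add: scaleC_scaleC)
  then have "range (\<lambda>x :: bidisc_algebra. c *\<^sub>C x) = UNIV" by blast
  then show ?thesis by (simp add: fin_codim_def exI[of _ "{}"])
qed

lemma fin_codim_symbol:
  assumes cod: "fin_codim (range (shifted \<mu> T))"
  shows "fin_codim (range ((*) (symbol \<mu>)))"
proof -
  have "fin_codim (range (shifted (\<mu> ^ m) (T ^^ m)))"
  proof (rule shifted_power_induct[OF T_bounded_clinear _ _ _ m_pos])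
    show "fin_codim (range (shifted z T))" if "z ^ m = \<mu> ^ m" for z
      using eigenvalue_orbit[of "\<lambda>z. fin_codim (range (shifted z T))", OF cod _ _ that] fin_codim_step by blast
    show "fin_codim (range (S \<circ> S'))"
      if "bounded_clinear S" "bounded_clinear S'" "fin_codim (range S)" "fin_codim (range S')"
      for S S' :: "bidisc_algebra \<Rightarrow> bidisc_algebra"
      by (rule fin_codim_compose[OF that(1,3,2,4)])
    show "fin_codim (range (\<lambda>x :: bidisc_algebra. c *\<^sub>C x))" if "c \<noteq> 0" for c
      by (rule fin_codim_const[OF that])
  qed
  then show ?thesis by (simp add: shifted_T_power)
qed

text \<open>By the symmetry multiplication by the symbol would have range of finite codimension. A
  zero on the torus of a nonzero symbol contradicts the lower bound that injectivity would give; any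
  other zero entails infinitely many zeros.\<close>

lemma not_fin_codim_shifted:
  assumes t: "t \<in> closed_bidisc" "bd_apply (symbol \<mu>) t = 0"
  shows "\<not> fin_codim (range (shifted \<mu> T))"
proof
  assume "fin_codim (range (shifted \<mu> T))"
  then have cod: "fin_codim (range ((*) (symbol \<mu>)))" by (rule fin_codim_symbol)
  show False
  proof (cases "t \<in> torus \<and> symbol \<mu> \<noteq> 0")
    case True
    then have "bounded_below ((*) (symbol \<mu>))"
      by (intro bounded_below_fin_codim bounded_clinear_times cod) simp
    then obtain c where c: "c > 0" "\<And>f. c * norm f \<le> norm (symbol \<mu> * f)"
      unfolding bounded_below_def by blast
    obtain f where "norm f = 1" "norm (symbol \<mu> * f) < c"
      using times_not_bounded_below[OF _ t(2) c(1)] True by blast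
    then show False using c(2)[of f] by simp
  next
    case False
    obtain t' where "t' \<in> closed_bidisc" "t' \<notin> torus" "bd_apply (symbol \<mu>) t' = 0"
    proof (cases "t \<in> torus")
      case True
      then have "symbol \<mu> = 0" using False by simp
      then show ?thesis by (intro that[of "(0, 0)"]) auto
    qed (use t that in blast)
    then show False using infinite_zeros infinite_zeros_imp_not_fin_codim cod by blast
  qed
qed

text \<open>An eigenvector times any polynomial in \<open>coord1 ^ m\<close> is again an
  eigenvector, so a nonzero eigenspace is infinite-dimensional.\<close>

lemma fin_dim_kernel_imp_inj:
  assumes fd: "fin_dim {f. shifted \<mu> T f = 0}" and f: "shifted \<mu> T f = 0"
  shows "f = 0"
proof (rule ccontr)
  assume f0: "f \<noteq> 0"
  obtain B where B: "finite B" "{f. shifted \<mu> T f = 0} \<subseteq> complex_vector.span B"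
    using fd by (auto simp: fin_dim_def)
  have X: "T ((coord1 ^ m) ^ i * f) = (coord1 ^ m) ^ i * T f" for i
  proof -
    have "(\<alpha>1 *\<^sub>C coord1) ^ m = coord1 ^ m"
      by (rule bd_eqI) (simp add: power_mult_distrib root_power_m)
    then show ?thesis by (simp add: T_apply dilate_hom dilate_power dilate_coord mult_ac)
  qed
  have "shifted \<mu> T ((coord1 ^ m) ^ i * f) = (coord1 ^ m) ^ i * shifted \<mu> T f" for i
    by (simp add: shifted_def X right_diff_distrib)
  then have "shifted \<mu> T ((coord1 ^ m) ^ i * f) = 0" for i
    using f by simp
  then have "\<exists>y\<in>{0}. \<exists>b\<in>complex_vector.span B. (coord1 ^ m) ^ i * f = y + b" for i
    using B(2) by auto
  then obtain n c where c: "\<exists>i\<le>n. c i \<noteq> 0" "(\<Sum>i\<le>n. c i *\<^sub>C ((coord1 ^ m) ^ i * f)) \<in> {0}"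
    using nontrivial_combination[OF complex_vector.subspace_single_0 B(1), of "\<lambda>i. (coord1 ^ m) ^ i * f"] by meson
  then have "(\<Sum>i\<le>n. c i *\<^sub>C (coord1 ^ m) ^ i) * f = 0" by (simp add: sum_distrib_right)
  then have "(\<Sum>i\<le>n. c i *\<^sub>C (coord1 ^ m) ^ i) = 0" using f0 by simp
  then show False using coord_power_independent[of coord1 m c n] m_pos c(1) by auto
qed

lemma not_semi_Fredholm_shifted:
  assumes t: "t \<in> torus" "bd_apply (symbol \<mu>) t = 0"
  shows "\<not> semi_Fredholm (shifted \<mu> T)"
proof
  assume "semi_Fredholm (shifted \<mu> T)"
  then consider "upper_semi_Fredholm (shifted \<mu> T)" | "lower_semi_Fredholm (shifted \<mu> T)"
    unfolding semi_Fredholm_def by blast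
  then show False
  proof cases
    case 1
    then have "bounded_below (shifted \<mu> T)"
      using bounded_below_closed_range fin_dim_kernel_imp_inj unfolding upper_semi_Fredholm_def by blast
    then show False using not_bounded_below_shifted[OF t] by blast
  next
    case 2
    then show False using not_fin_codim_shifted[OF _ t(2)] t(1) by (auto simp: lower_semi_Fredholm_def)
  qed
qed

lemma spectra:
  shows "spectrum T = {\<mu>. \<exists>t\<in>closed_bidisc. bd_apply (symbol \<mu>) t = 0}"
    and "lower_semi_Fredholm_spectrum T = {\<mu>. \<exists>t\<in>closed_bidisc. bd_apply (symbol \<mu>) t = 0}"
    and "approx_point_spectrum T = {\<mu>. \<exists>t\<in>torus. bd_apply (symbol \<mu>) t = 0}"
    and "semi_Fredholm_spectrum T = {\<mu>. \<exists>t\<in>torus. bd_apply (symbol \<mu>) t = 0}"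
proof -
  have 1: "spectrum T \<subseteq> {\<mu>. \<exists>t\<in>closed_bidisc. bd_apply (symbol \<mu>) t = 0}"
    using not_in_spectrum_T by blast
  have 2: "{\<mu>. \<exists>t\<in>closed_bidisc. bd_apply (symbol \<mu>) t = 0} \<subseteq> lower_semi_Fredholm_spectrum T"
    using not_fin_codim_shifted unfolding lower_semi_Fredholm_spectrum_def lower_semi_Fredholm_def by blast
  note 3 = lower_semi_Fredholm_subset_spectrum[OF T_bounded_clinear]
  show "spectrum T = {\<mu>. \<exists>t\<in>closed_bidisc. bd_apply (symbol \<mu>) t = 0}"
    "lower_semi_Fredholm_spectrum T = {\<mu>. \<exists>t\<in>closed_bidisc. bd_apply (symbol \<mu>) t = 0}"
    using 1 2 3 by blast+
  show "approx_point_spectrum T = {\<mu>. \<exists>t\<in>torus. bd_apply (symbol \<mu>) t = 0}"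
    using approx_point_spectrum_iff[OF T_bounded_clinear] bounded_below_shifted not_bounded_below_shifted
    by blast
  show "semi_Fredholm_spectrum T = {\<mu>. \<exists>t\<in>torus. bd_apply (symbol \<mu>) t = 0}"
    using upper_semi_Fredholm_bounded_below[OF bounded_clinear_shifted[OF T_bounded_clinear]]
      bounded_below_shifted not_semi_Fredholm_shifted
    unfolding semi_Fredholm_spectrum_def semi_Fredholm_def by blast
qed

lemma bd_apply_weight:
  assumes "z \<in> closed_bidisc"
  shows "bd_apply (weight n) z = cocycle (\<lambda>(z1, z2). (\<alpha>1 * z1, \<alpha>2 * z2)) (bd_apply w) n z"
proof (induction n)
  case 0
  then show ?case using assms by (simp add: weight_def)
next
  case (Suc n)
  have "((\<lambda>(z1, z2). (\<alpha>1 * z1, \<alpha>2 * z2)) ^^ k) z = (\<alpha>1 ^ k * fst z, \<alpha>2 ^ k * snd z)" for k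
    by (induction k) (auto simp: mult.assoc)
  then show ?case using Suc assms by (simp add: weight_def norm_power)
qed

end

theorem proposition4p1:
  fixes \<alpha>1 \<alpha>2 :: complex and p q m :: nat
    and \<phi> :: "complex \<times> complex \<Rightarrow> complex \<times> complex"
    and w :: bidisc_algebra and T :: "bidisc_algebra \<Rightarrow> bidisc_algebra"
  assumes "p \<ge> 1" and "q \<ge> 1"
    and "primitive_root_of_unity p \<alpha>1" and "primitive_root_of_unity q \<alpha>2"
    and "\<phi> = (\<lambda>(z1, z2). (\<alpha>1 * z1, \<alpha>2 * z2))"
    and "m = lcm p q"
    and "\<And>f z. z \<in> closed_bidisc \<Longrightarrow> bd_apply (T f) z = bd_apply w z * bd_apply f (\<phi> z)"
  shows "(spectrum T = lower_semi_Fredholm_spectrum T \<and>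
          lower_semi_Fredholm_spectrum T
            = {\<mu>. \<exists>t\<in>closed_bidisc. \<mu> ^ m = cocycle \<phi> (bd_apply w) m t}) \<and>
         (approx_point_spectrum T = semi_Fredholm_spectrum T \<and>
          semi_Fredholm_spectrum T
            = {\<mu>. \<exists>t\<in>torus. \<mu> ^ m = cocycle \<phi> (bd_apply w) m t})"
proof -
  have "T = (\<lambda>f. w * dilate \<alpha>1 \<alpha>2 f)"
    using primitive_root_norm[OF assms(3)] primitive_root_norm[OF assms(4)]
    by (intro ext bd_eqI) (simp add: assms(5,7) case_prod_unfold)
  then interpret weighted_rotation \<alpha>1 \<alpha>2 p q m w T
    using assms by unfold_locales
  have "bd_apply (symbol \<mu>) t = 0 \<longleftrightarrow> \<mu> ^ m = cocycle \<phi> (bd_apply w) m t"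
    if "t \<in> closed_bidisc" for \<mu> t
    using that by (simp add: symbol_def bd_apply_weight assms(5))
  then show ?thesis by (auto simp: spectra)
qed

end
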